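(* Let $\frac12\le\varphi\le2$ and put $$\psi_1=\frac{\varphi+1+\sqrt{(\varphi+1)^2+4}}{2},\qquad \psi_2=\frac{\frac{\varphi+1}{\varphi}+\sqrt{\left(\frac{\varphi+1}{\varphi}\right)^2+4}}{2}.$$ Then $$\mu_\varphi\le\max\left(\frac{2}{\psi_1+1},\frac{2}{\psi_2+1}\right)\quad\text{and}\quad \mu^{\mathrm{hom}}_\varphi\le\max\left(\frac{2}{\psi_1+1},\frac{2}{\psi_2+1}\right).$$
   Context: A necklace is a cyclic sequence of beads, each colored red or blue. A matching is a set of mutually disjoint pairs (edges) of beads. In the heterogeneous model each pair consists of one red and one blue bead; in the homogeneous model each pair consists of two beads of the same color. A matching is cross-free if for any two of its edges $ab$ and $cd$, one of the two arcs between $a$ and $b$ is disjoint from $\{c,d\}$ while the other arc contains $\{c,d\}$. A secant partitions the necklace into two contiguous arcs $A_1,A_2$; a matching is secant-respecting (for that secant) if every edge has one end in $A_1$ and the other in $A_2$. A matching is proper if it is cross-free and secant-respecting for some secant. For $\varphi>0$ let $\mathcal N_\varphi(N)$ be the set of necklaces with $N=(1+\varphi)n$ beads of which $\varphi n$ are red and $n$ are blue, with integer parts ignored; precisely, with $p=\varphi/(1+\varphi)$, necklaces with $\lfloor pN\rfloor$ red and $N-\lfloor pN\rfloor$ blue beads. In the heterogeneous model let $\mu_\varphi(N)=\min_{L\in\mathcal N_\varphi(N)}\max_M 2|M|$, where $M$ ranges over the proper matchings of $L$, and $\mu_\varphi=\limsup_{N\to\infty}\mu_\varphi(N)/N$.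 Define $\mu^{\mathrm{hom}}_\varphi(N)$ and $\mu^{\mathrm{hom}}_\varphi$ in the same way for the homogeneous model. *)

theory Defs
  imports Complex_Main "HOL-Library.Liminf_Limsup" "HOL-Library.Extended_Real"
begin

datatype color = Red | Blue

text \<open>
  A necklace with N beads is a list of colors of length N, read cyclically: the beads are the
  positions \<open>0, \<dots>, N - 1\<close>, and bead N - 1 is followed by bead 0. Rotations of a list are not
  identified; they have the same matchings up to relabelling, so minima over lists and over
  rotation classes agree.
\<close>

definition matching :: "nat \<Rightarrow> nat set set \<Rightarrow> bool" where
  "matching N M \<longleftrightarrow>
     (\<forall>e\<in>M. e \<subseteq> {..<N} \<and> card e = 2) \<and>
     (\<forall>e\<in>M. \<forall>f\<in>M. e \<noteq> f \<longrightarrow> e \<inter> f = {})"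

definition bichromatic :: "color list \<Rightarrow> nat set \<Rightarrow> bool" where
  "bichromatic L e \<longleftrightarrow> (\<exists>a b. e = {a, b} \<and> L ! a = Red \<and> L ! b = Blue)"

definition monochromatic :: "color list \<Rightarrow> nat set \<Rightarrow> bool" where
  "monochromatic L e \<longleftrightarrow> (\<forall>a\<in>e. \<forall>b\<in>e. L ! a = L ! b)"

text \<open>The beads strictly between a and b when moving from a in increasing cyclic direction
  (for distinct beads a and b).\<close>

definition arc_between :: "nat \<Rightarrow> nat \<Rightarrow> nat \<Rightarrow> nat set" where
  "arc_between N a b = (\<lambda>k. (a + k) mod N) ` {0<..<(b + N - a) mod N}"

definition cross_free :: "nat \<Rightarrow> nat set set \<Rightarrow> bool" where
  "cross_free N M \<longleftrightarrow>
     (\<forall>a b c d. {a, b} \<in> M \<longrightarrow> {c, d} \<in> M \<longrightarrow> {a, b} \<noteq> {c, d} \<longrightarrow>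
        {c, d} \<inter> arc_between N a b = {} \<and> {c, d} \<subseteq> arc_between N b a \<or>
        {c, d} \<inter> arc_between N b a = {} \<and> {c, d} \<subseteq> arc_between N a b)"

definition contiguous_arc :: "nat \<Rightarrow> nat set \<Rightarrow> bool" where
  "contiguous_arc N A \<longleftrightarrow> (\<exists>s l. l \<le> N \<and> A = (\<lambda>k. (s + k) mod N) ` {..<l})"

text \<open>A secant with an empty side is allowed; the only matching respecting it is the empty one.\<close>

definition secant :: "nat \<Rightarrow> nat set \<Rightarrow> nat set \<Rightarrow> bool" where
  "secant N A1 A2 \<longleftrightarrow>
     contiguous_arc N A1 \<and> contiguous_arc N A2 \<and> A1 \<union> A2 = {..<N} \<and> A1 \<inter> A2 = {}"

definition secant_respecting :: "nat set \<Rightarrow> nat set \<Rightarrow> nat set set \<Rightarrow> bool" where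
  "secant_respecting A1 A2 M \<longleftrightarrow> (\<forall>e\<in>M. \<exists>a\<in>A1. \<exists>b\<in>A2. e = {a, b})"

definition proper :: "nat \<Rightarrow> nat set set \<Rightarrow> bool" where
  "proper N M \<longleftrightarrow>
     cross_free N M \<and> (\<exists>A1 A2. secant N A1 A2 \<and> secant_respecting A1 A2 M)"

text \<open>The parameter \<open>E\<close> says which pairs of beads may be matched.\<close>

definition proper_matchings :: "(color list \<Rightarrow> nat set \<Rightarrow> bool) \<Rightarrow> color list \<Rightarrow> nat set set set" where
  "proper_matchings E L =
     {M. matching (length L) M \<and> (\<forall>e\<in>M. E L e) \<and> proper (length L) M}"

definition necklaces :: "real \<Rightarrow> nat \<Rightarrow> color list set" where
  "necklaces \<phi> N =
     {L. length L = N \<and> int (count_list L Red) = \<lfloor>\<phi> / (1 + \<phi>) * real N\<rfloor>}"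

definition min_max_matched :: "(color list \<Rightarrow> nat set \<Rightarrow> bool) \<Rightarrow> real \<Rightarrow> nat \<Rightarrow> nat" where
  "min_max_matched E \<phi> N =
     Min ((\<lambda>L. Max ((\<lambda>M. 2 * card M) ` proper_matchings E L)) ` necklaces \<phi> N)"

definition mu_het :: "real \<Rightarrow> ereal" where
  "mu_het \<phi> = limsup (\<lambda>N. ereal (real (min_max_matched bichromatic \<phi> N) / real N))"

definition mu_hom :: "real \<Rightarrow> ereal" where
  "mu_hom \<phi> = limsup (\<lambda>N. ereal (real (min_max_matched monochromatic \<phi> N) / real N))"

text \<open>The minimum and the maximum range over finite nonempty sets.\<close>

lemma finite_proper_matchings: "finite (proper_matchings E L)"
proof (rule finite_subset)
  show "proper_matchings E L \<subseteq> Pow (Pow {..<length L})"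
    by (auto simp: proper_matchings_def matching_def)
qed simp

lemma empty_in_proper_matchings: "{} \<in> proper_matchings E L"
proof -
  let ?N = "length L"
  have "contiguous_arc ?N {}"
    unfolding contiguous_arc_def by (intro exI[of _ 0]) auto
  moreover have "contiguous_arc ?N {..<?N}"
    unfolding contiguous_arc_def by (intro exI[of _ 0] exI[of _ ?N]) (auto simp: image_iff)
  ultimately have "secant ?N {} {..<?N}"
    by (simp add: secant_def)
  then show ?thesis
    by (auto simp: proper_matchings_def matching_def proper_def cross_free_def
        secant_respecting_def)
qed

lemma finite_necklaces: "finite (necklaces \<phi> N)"
proof (rule finite_subset)
  have "(UNIV :: color set) = {Red, Blue}"
    using color.exhaust by auto
  then have "finite (UNIV :: color set)"
    by (metis finite.emptyI finite.insertI)
  then show "finite {L :: color list. set L \<subseteq> UNIV \<and> length L = N}"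
    by (rule finite_lists_length_eq)
qed (auto simp: necklaces_def)

lemma necklaces_nonempty:
  assumes "\<phi> > 0"
  shows "necklaces \<phi> N \<noteq> {}"
proof -
  define x where "x = \<phi> / (1 + \<phi>) * real N"
  define r where "r = nat \<lfloor>x\<rfloor>"
  have x0: "x \<ge> 0" and xN: "x \<le> real N"
    using assms mult_right_mono[of "\<phi> / (1 + \<phi>)" 1 "real N"] by (auto simp: x_def)
  then have r: "int r = \<lfloor>x\<rfloor>" and "r \<le> N"
    by (auto simp: r_def floor_le_iff nat_le_iff)
  have rep: "count_list (replicate k c) Red = (if c = Red then k else 0)" for k c
    by (induction k) auto
  have "replicate r Red @ replicate (N - r) Blue \<in> necklaces \<phi> N"
    using \<open>r \<le> N\<close> r by (simp add: necklaces_def rep x_def)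
  then show ?thesis
    by blast
qed

end

theory Submission
  imports Defs
begin

text \<open>
  The extremal necklaces consist of many sections of equal length. A section is a sequence of
  alternating red and blue runs; its pattern is ``red heavy'' (red share \<open>1 - \<theta>\<close>) on some long
  pieces and ``blue heavy'' (blue share \<open>1 - \<theta>\<close>) on the others, with overall red share
  \<open>q = \<phi> / (1 + \<phi>)\<close>. The scales are nested: the longer the runs of a section, the shorter its pieces.

  A secant and a proper matching form a nested family of edges, so edges between different pairs of
  sections use up disjoint intervals. Take two sections, and consider a heavy piece of the finer one.
  The coarser section looks balanced (red share \<open>q\<close>) against the whole piece, and each of its runs
  faces many runs of the piece. Beads of the light colour of the piece are matched at most \<open>\<theta>\<close> times
  per bead of the piece. A matching of \<open>k\<close> heavy beads uses an interval of length \<open>x\<close> with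
  \<open>k \<le> (1 - \<theta>) x\<close>; with the weight \<open>\<mu> = \<theta> / (1 - \<theta>)\<close> this gives \<open>k \<le> \<theta> x + (1 - \<mu>) k\<close>, and the
  total of the last terms is at most \<open>(1 - \<mu>) max q (1 - q)\<close> times the length of the coarse interval.
  For the root \<open>\<theta> = 1 / (\<psi> + 1)\<close> of \<open>(1 - 2\<theta>) max q (1 - q) = \<theta> (1 - \<theta>)\<close> both sides contribute at
  most \<open>\<theta>\<close> edges per bead. Whether matched beads have equal or opposite colours is immaterial.
\<close>

section \<open>Nested edge sets and periodic colourings\<close>

text \<open>Models the edges of a proper matching after the necklace is cut at one end of the
  secant: first components lie on one arc, second components on the other. The strict inequalities
  also encode disjointness of distinct edges.\<close>

definition nested :: "(nat \<times> nat) set \<Rightarrow> bool" where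
  "nested M \<longleftrightarrow> (\<forall>e\<in>M. \<forall>f\<in>M. e = f \<or> fst e < fst f \<and> snd f < snd e \<or>
     fst f < fst e \<and> snd e < snd f)"

text \<open>Written without \<open>Min\<close> and \<open>Max\<close>, so that the hull of the empty
  set is empty and its \<open>extent\<close> is 0.\<close>

definition range_hull :: "nat set \<Rightarrow> nat set" where
  "range_hull S = {x. \<exists>a\<in>S. \<exists>b\<in>S. a \<le> x \<and> x \<le> b}"

definition extent :: "nat set \<Rightarrow> nat" where
  "extent S = card (range_hull S)"

lemma subset_range_hull: "S \<subseteq> range_hull S"
  by (auto simp: range_hull_def)

lemma range_hull_eq_interval:
  assumes "finite S" "S \<noteq> {}"
  shows "range_hull S = {Min S..<Min S + extent S}"
proof -
  have *: "range_hull S = {Min S..Max S}"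
  proof (intro equalityI subsetI)
    fix x assume "x \<in> {Min S..Max S}"
    then show "x \<in> range_hull S"
      unfolding range_hull_def using Min_in[OF assms] Max_in[OF assms] by auto
  next
    fix x assume "x \<in> range_hull S"
    then obtain a b where "a \<in> S" "b \<in> S" "a \<le> x" "x \<le> b"
      by (auto simp: range_hull_def)
    then show "x \<in> {Min S..Max S}"
      using Min_le[OF assms(1), of a] Max_ge[OF assms(1), of b] by simp
  qed
  then have "extent S = Suc (Max S) - Min S"
    by (simp add: extent_def)
  moreover have "Min S \<le> Max S"
    using assms by (simp add: Min_le)
  ultimately have "Suc (Max S) = Min S + extent S"
    by linarith
  with * show ?thesis
    by (simp add: atLeastLessThanSuc_atLeastAtMost[symmetric])
qed

lemma finite_range_hull: "finite S \<Longrightarrow> finite (range_hull S)"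
  by (cases "S = {}") (simp_all add: range_hull_eq_interval, simp add: range_hull_def)

lemma extent_mono: "finite T \<Longrightarrow> S \<subseteq> T \<Longrightarrow> extent S \<le> extent T"
  unfolding extent_def by (rule card_mono) (auto simp: finite_range_hull range_hull_def)

lemma extent_le: "S \<subseteq> {x..<x + s} \<Longrightarrow> extent S \<le> s"
proof -
  assume "S \<subseteq> {x..<x + s}"
  then have "range_hull S \<subseteq> {x..<x + s}"
    by (force simp: range_hull_def)
  from card_mono[OF _ this] show ?thesis
    by (simp add: extent_def)
qed

text \<open>Separated sets have disjoint hulls inside the hull of \<open>S\<close>. \<open>R\<close>
  covers both orders: as the classes advance, left ends move up and right ends move down.\<close>

lemma sum_extent_le:
  assumes "finite K" "finite S" and sub: "\<And>k. k \<in> K \<Longrightarrow> A k \<subseteq> S"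
    and sep: "\<And>k k' x y. k \<in> K \<Longrightarrow> k' \<in> K \<Longrightarrow> k < k' \<Longrightarrow> x \<in> A k \<Longrightarrow> y \<in> A k' \<Longrightarrow> R x y"
    and R: "R = (<) \<or> R = (>)"
  shows "(\<Sum>k\<in>K. extent (A (k::int))) \<le> extent S"
proof -
  have fin: "finite (A k)" if "k \<in> K" for k
    using sub[OF that] assms(2) by (rule finite_subset)
  have dis: "range_hull (A k) \<inter> range_hull (A k') = {}" if "k \<in> K" "k' \<in> K" "k < k'" for k k'
    using sep[OF that] R by (fastforce simp: range_hull_def)
  have "(\<Sum>k\<in>K. extent (A k)) = card (\<Union>k\<in>K. range_hull (A k))"
    unfolding extent_def
  proof (rule card_UN_disjoint[symmetric])
    show "\<forall>k\<in>K. \<forall>k'\<in>K. k \<noteq> k' \<longrightarrow> range_hull (A k) \<inter> range_hull (A k') = {}"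
      using dis by (metis Int_commute linorder_neqE)
  qed (use assms(1) fin in \<open>auto simp: finite_range_hull\<close>)
  also have "\<dots> \<le> card (range_hull S)"
    by (rule card_mono) (use assms(2) sub in \<open>auto simp: finite_range_hull, force simp: range_hull_def\<close>)
  finally show ?thesis
    by (simp add: extent_def)
qed

lemma nested_subset: "nested M \<Longrightarrow> M' \<subseteq> M \<Longrightarrow> nested M'"
  unfolding nested_def by blast

lemma nested_inj_on: "nested M \<Longrightarrow> inj_on fst M" "nested M \<Longrightarrow> inj_on snd M"
  unfolding nested_def inj_on_def by force+

lemma nested_swap:
  assumes "nested M"
  shows "nested (prod.swap ` M)"
  unfolding nested_def
proof (intro ballI, elim imageE, hypsubst)
  fix e f assume "e \<in> M" "f \<in> M"
  then have "e = f \<or> fst e < fst f \<and> snd f < snd e \<or> fst f < fst e \<and> snd e < snd f"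
    using assms unfolding nested_def by blast
  then show "prod.swap e = prod.swap f \<or> fst (prod.swap e) < fst (prod.swap f) \<and>
      snd (prod.swap f) < snd (prod.swap e) \<or> fst (prod.swap f) < fst (prod.swap e) \<and>
      snd (prod.swap e) < snd (prod.swap f)"
    by auto
qed

text \<open>Since \<open>key\<close> is monotone along left ends, its level sets are consecutive
  blocks of nested edges and hence separated on both arcs.\<close>

lemma nested_partition:
  fixes key :: "nat \<times> nat \<Rightarrow> int"
  assumes "finite M" "nested M"
    and mono: "\<And>e f. e \<in> M \<Longrightarrow> f \<in> M \<Longrightarrow> fst e < fst f \<Longrightarrow> key e \<le> key f"
  shows "(\<Sum>k\<in>key ` M. extent (fst ` {e\<in>M. key e = k})) \<le> extent (fst ` M)"
    and "(\<Sum>k\<in>key ` M. extent (snd ` {e\<in>M. key e = k})) \<le> extent (snd ` M)"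
    and "(\<Sum>k\<in>key ` M. card {e\<in>M. key e = k \<and> B e}) = card {e\<in>M. B e}"
proof -
  have *: "fst e < fst f \<and> snd f < snd e" if "e \<in> M" "f \<in> M" "key e < key f" for e f
    using that assms(2) mono[of f e] unfolding nested_def by force
  show "(\<Sum>k\<in>key ` M. extent (fst ` {e\<in>M. key e = k})) \<le> extent (fst ` M)"
    by (rule sum_extent_le[where R = "(<)"]) (use assms(1) * in auto)
  show "(\<Sum>k\<in>key ` M. extent (snd ` {e\<in>M. key e = k})) \<le> extent (snd ` M)"
    by (rule sum_extent_le[where R = "(>)"]) (use assms(1) * in auto)
  have "card {e\<in>M. B e} = card (\<Union>k\<in>key ` M. {e\<in>M. key e = k \<and> B e})"
    by (rule arg_cong[where f = card]) auto
  also have "\<dots> = (\<Sum>k\<in>key ` M. card {e\<in>M. key e = k \<and> B e})"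
    by (rule card_UN_disjoint) (use assms(1) in auto)
  finally show "(\<Sum>k\<in>key ` M. card {e\<in>M. key e = k \<and> B e}) = card {e\<in>M. B e}" ..
qed

text \<open>Adds up a bound proved class by class. \<open>\<gamma>\<close> is the boundary error of
  one class; the \<open>\<delta>\<close> term is passed through as a count of edges with
  \<open>B\<close>, so that these can be bounded for all classes together.\<close>

lemma nested_card_le:
  fixes key :: "nat \<times> nat \<Rightarrow> int" and \<alpha> \<beta> \<gamma> \<delta> :: real
  assumes "finite M" "nested M"
    and "\<And>e f. e \<in> M \<Longrightarrow> f \<in> M \<Longrightarrow> fst e < fst f \<Longrightarrow> key e \<le> key f"
    and nonneg: "\<alpha> \<ge> 0" "\<beta> \<ge> 0"
    and bound: "\<And>k. k \<in> key ` M \<Longrightarrow>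
      card {e\<in>M. key e = k} \<le> \<alpha> * extent (fst ` {e\<in>M. key e = k}) +
        \<beta> * extent (snd ` {e\<in>M. key e = k}) + \<gamma> + \<delta> * card {e\<in>M. key e = k \<and> B e}"
  shows "card M \<le> \<alpha> * extent (fst ` M) + \<beta> * extent (snd ` M) + \<gamma> * card (key ` M) +
    \<delta> * card {e\<in>M. B e}"
proof -
  have part: "(\<Sum>k\<in>key ` M. extent (fst ` {e\<in>M. key e = k})) \<le> extent (fst ` M)"
    "(\<Sum>k\<in>key ` M. extent (snd ` {e\<in>M. key e = k})) \<le> extent (snd ` M)"
    "(\<Sum>k\<in>key ` M. card {e\<in>M. key e = k \<and> C e}) = card {e\<in>M. C e}" for C
    by (rule nested_partition[OF assms(1,2)], erule (2) assms(3))+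
  have "real (card M) = real (\<Sum>k\<in>key ` M. card {e\<in>M. key e = k})"
    using part(3)[where C="\<lambda>_. True"] by simp
  also have "\<dots> \<le> (\<Sum>k\<in>key ` M. \<alpha> * extent (fst ` {e\<in>M. key e = k}) +
        \<beta> * extent (snd ` {e\<in>M. key e = k}) + \<gamma> + \<delta> * card {e\<in>M. key e = k \<and> B e})"
    unfolding of_nat_sum by (rule sum_mono) (rule bound)
  also have "\<dots> = \<alpha> * real (\<Sum>k\<in>key ` M. extent (fst ` {e\<in>M. key e = k})) +
      \<beta> * real (\<Sum>k\<in>key ` M. extent (snd ` {e\<in>M. key e = k})) + \<gamma> * card (key ` M) +
      \<delta> * real (\<Sum>k\<in>key ` M. card {e\<in>M. key e = k \<and> B e})"
    by (simp add: sum.distrib sum_distrib_left)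
  also have "\<dots> \<le> \<alpha> * extent (fst ` M) + \<beta> * extent (snd ` M) + \<gamma> * card (key ` M) +
    \<delta> * card {e\<in>M. B e}"
    unfolding part(3) unfolding of_nat_sum[symmetric]
    using mult_left_mono[OF of_nat_mono[OF part(1)] nonneg(1)]
      mult_left_mono[OF of_nat_mono[OF part(2)] nonneg(2)] by linarith
  finally show ?thesis .
qed

section \<open>Counting in periodic colourings and numbering of runs\<close>

lemma card_periodic_le:
  assumes "P > 0" and per: "\<And>t. A (t mod P) = A t"
  shows "card {t\<in>{x..<x + s * P}. A t} \<le> s * card {t\<in>{..<P}. A t}"
proof (induction s)
  case (Suc s)
  let ?y = "x + s * P"
  have "inj_on (\<lambda>t. t mod P) {?y..<?y + P}"
  proof (rule linorder_inj_onI')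
    fix t t' assume *: "t \<in> {?y..<?y + P}" "t' \<in> {?y..<?y + P}" "t < t'"
    then have "\<not> P dvd t' - t"
      by (intro nat_dvd_not_less) auto
    then show "t mod P \<noteq> t' mod P"
      using *(3) by (metis mod_eq_dvd_iff_nat less_imp_le_nat)
  qed
  then have "card {t\<in>{?y..<?y + P}. A t} \<le> card {t\<in>{..<P}. A t}"
    by (intro card_inj_on_le[where f = "\<lambda>t. t mod P"])
      (use assms in \<open>auto simp: inj_on_def\<close>)
  moreover have "{t\<in>{x..<x + Suc s * P}. A t} = {t\<in>{x..<?y}. A t} \<union> {t\<in>{?y..<?y + P}. A t}"
    by auto
  ultimately show ?case
    using Suc card_Un_le[of "{t\<in>{x..<?y}. A t}" "{t\<in>{?y..<?y + P}. A t}"] by simp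
qed simp

lemma card_periodic_le_real:
  fixes \<kappa> :: real and s P :: nat
  assumes "P > 0" and per: "\<And>t. A (t mod P) = A t"
    and c: "card {t\<in>{..<P}. A t} \<le> \<kappa> * real P"
  shows "card {t\<in>{x..<x + s}. A t} \<le> \<kappa> * (s + P)"
proof -
  \<comment> \<open>Round \<open>s\<close> up to whole periods; this adds at most one period, the
    \<open>P\<close> in the bound.\<close>
  define k where "k = s div P + 1"
  have "0 \<le> \<kappa> * real P"
    using c by (rule order_trans[OF of_nat_0_le_iff])
  then have "\<kappa> \<ge> 0"
    using \<open>P > 0\<close> by (simp add: zero_le_mult_iff)
  have sk: "s \<le> k * P" "k * P \<le> s + P"
    using dividend_less_times_div[OF \<open>P > 0\<close>, of s] times_div_less_eq_dividend[of P s]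
    by (simp_all add: k_def add_mult_distrib mult.commute)
  have "card {t\<in>{x..<x + s}. A t} \<le> card {t\<in>{x..<x + k * P}. A t}"
    by (rule card_mono) (use sk in auto)
  also have "\<dots> \<le> k * card {t\<in>{..<P}. A t}"
    using assms by (intro card_periodic_le)
  finally have "real (card {t\<in>{x..<x + s}. A t}) \<le> real k * card {t\<in>{..<P}. A t}"
    by (metis of_nat_le_iff of_nat_mult)
  also have "\<dots> \<le> real k * (\<kappa> * real P)"
    by (intro mult_left_mono c) auto
  also have "\<dots> = \<kappa> * real (k * P)"
    by simp
  also have "\<dots> \<le> \<kappa> * real (s + P)"
    using sk \<open>\<kappa> \<ge> 0\<close> by (intro mult_left_mono of_nat_mono) auto
  finally show ?thesis
    by simp
qed

text \<open>A period is meant to be a stretch with \<open>A\<close> followed by one without, so runs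
  are numbered in order and the parity reveals \<open>A\<close>. It serves both for colour runs
  (\<open>per\<close>, \<open>col\<close>) and for pieces (\<open>superper\<close>,
  \<open>heavy\<close>).\<close>

definition run_index :: "nat \<Rightarrow> (nat \<Rightarrow> bool) \<Rightarrow> nat \<Rightarrow> nat" where
  "run_index P A t = 2 * (t div P) + (if A t then 0 else 1)"

lemma run_index_eqD: "run_index P A t = run_index P A t' \<Longrightarrow> A t = A t'"
proof -
  assume "run_index P A t = run_index P A t'"
  then have "even (run_index P A t) = even (run_index P A t')"
    by simp
  then show ?thesis
    by (simp add: run_index_def split: if_splits)
qed

lemma run_index_mono:
  assumes "\<And>t t'. t \<le> t' \<Longrightarrow> t div P = t' div P \<Longrightarrow> A t' \<Longrightarrow> A t" "t \<le> t'"
  shows "run_index P A t \<le> run_index P A t'"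
  using assms(1)[of t t'] assms(2) div_le_mono[of t t' P] unfolding run_index_def
  by (cases "t div P = t' div P") auto

text \<open>An interval of length \<open>s\<close> meets at most \<open>s div P + 2\<close> periods,
  with at most two runs in each.\<close>

lemma card_run_index_le:
  assumes "P > 0" "finite S"
  shows "card (run_index P A ` S) \<le> 2 * (extent S / P) + 4"
proof (cases "S = {}")
  case False
  let ?x = "Min S" and ?s = "extent S"
  have S: "S \<subseteq> {?x..<?x + ?s}"
    using subset_range_hull[of S] range_hull_eq_interval[OF assms(2) False] by simp
  have "run_index P A ` S \<subseteq> {2 * (?x div P)..<2 * (?x div P) + (2 * (?s div P) + 4)}"
  proof
    fix k assume "k \<in> run_index P A ` S"
    then obtain t where t: "t \<in> S" "k = run_index P A t"
      by blast
    with S have tt: "?x \<le> t" "t \<le> ?x + ?s"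
      by auto
    have "t div P \<le> (?x + ?s) div P"
      using tt by (simp add: div_le_mono)
    also have "\<dots> \<le> ?x div P + ?s div P + 1"
    proof -
      have "?x mod P + ?s mod P < 2 * P"
        using assms(1) mod_less_divisor[of P ?x] mod_less_divisor[of P ?s] by linarith
      then have "(?x mod P + ?s mod P) div P < 2"
        by (rule less_mult_imp_div_less)
      then show ?thesis
        unfolding div_add1_eq[of ?x ?s] by linarith
    qed
    finally show "k \<in> {2 * (?x div P)..<2 * (?x div P) + (2 * (?s div P) + 4)}"
      using t(2) div_le_mono[OF tt(1), of P] by (auto simp: run_index_def)
  qed
  from card_mono[OF _ this] have "card (run_index P A ` S) \<le> 2 * (?s div P) + 4"
    by simp
  then have "real (card (run_index P A ` S)) \<le> 2 * real (?s div P) + 4"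
    by linarith
  then show ?thesis
    using of_nat_div_le_of_nat[of ?s P, where 'a = real] by linarith
qed simp

section \<open>Matching two sections of different scales\<close>

text \<open>The share of the colour \<open>b\<close> (true for red) if a piece has \<open>a\<close> light beads in \<open>n\<close> and
  \<open>u\<close> out of \<open>n\<close> pieces are red heavy.\<close>

definition density :: "nat \<Rightarrow> nat \<Rightarrow> nat \<Rightarrow> bool \<Rightarrow> real" where
  "density n a u b =
    real (if b then u * (n - a) + (n - u) * a else u * a + (n - u) * (n - a)) / (real n)\<^sup>2"

text \<open>\<open>a / n\<close> is the rounded \<theta>, \<open>u / n\<close> the fraction of red
  heavy pieces, \<open>D\<close> a bound for both colour shares, and \<open>\<rho>\<close> the
  target number of edges per bead. The last condition is the rounded form of the inequality that
  determines \<theta>.\<close>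

locale multiscale =
  fixes n a u :: nat and D \<rho> :: real
  assumes n: "n \<ge> 1" and a: "2 * a \<le> n" and u: "u \<le> n"
    and density_le: "\<And>b. density n a u b \<le> D"
    and rho: "a / n \<le> \<rho>" "\<rho> \<le> 1" "(1 - 2 * (a / n)) * D \<le> \<rho> * (1 - a / n)"
begin

text \<open>Section \<open>i < n\<close> repeats its pattern of one red and one blue run with period \<open>per i\<close>. In each
  \<open>superper i\<close> the first \<open>u * reps i\<close> of these patterns are red heavy, the others blue heavy; \<open>per\<close>
  increases with \<open>i\<close> and \<open>superper\<close> decreases. True stands for red.\<close>

definition per :: "nat \<Rightarrow> nat" where "per i = n ^ (i + 1)"

definition reps :: "nat \<Rightarrow> nat" where "reps i = n ^ (2 * n - 2 * i)"

definition superper :: "nat \<Rightarrow> nat" where "superper i = per i * (n * reps i)"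

definition heavy :: "nat \<Rightarrow> nat \<Rightarrow> bool" where
  "heavy i t \<longleftrightarrow> t div per i mod (n * reps i) < u * reps i"

text \<open>Counted per \<open>n\<close> beads of a pattern; \<open>col\<close> scales it by
  \<open>n ^ i\<close> to the pattern length \<open>per i\<close>.\<close>

definition reds :: "bool \<Rightarrow> nat" where "reds h = (if h then n - a else a)"

definition col :: "nat \<Rightarrow> nat \<Rightarrow> bool" where
  "col i t \<longleftrightarrow> t mod per i < reds (heavy i t) * n ^ i"

lemma per_pos: "per i > 0" and superper_pos: "superper i > 0"
  using n by (simp_all add: per_def reps_def superper_def)

text \<open>The exponents are chosen for this: from one section to the next \<open>per\<close> grows
  and \<open>superper\<close> shrinks by the factor \<open>n\<close>, and even the last superperiod
  \<open>n ^ (n + 2)\<close> exceeds every \<open>per i\<close> with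
  \<open>i \<le> n\<close>.\<close>

lemma superper_eq: "i \<le> n \<Longrightarrow> superper i = n ^ (2 * n + 2 - i)"
proof -
  assume "i \<le> n"
  then have "(i + 1) + (1 + (2 * n - 2 * i)) = 2 * n + 2 - i"
    by linarith
  then show ?thesis
    unfolding superper_def per_def reps_def by (metis power_add power_one_right)
qed

lemma per_le: "i < j \<Longrightarrow> n * per i \<le> per j"
  using power_increasing[of "i + 2" "j + 1" n] n by (simp add: per_def)

lemma superper_le: "i < j \<Longrightarrow> j \<le> n \<Longrightarrow> n * superper j \<le> superper i"
  using power_increasing[of "Suc (2 * n + 2 - j)" "2 * n + 2 - i" n] n by (simp add: superper_eq)

lemma per_le_superper: "i \<le> n \<Longrightarrow> j \<le> n \<Longrightarrow> per i \<le> superper j"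
  using n power_increasing[of "i + 1" "2 * n + 2 - j" n] by (simp add: superper_eq per_def)

lemma superper_le_max:
  assumes "j \<le> n"
  shows "superper j \<le> n ^ (2 * n + 2)"
  unfolding superper_eq[OF assms] using n by (intro power_increasing) auto

lemma reds_le: "reds h \<le> n"
  using a by (simp add: reds_def)

text \<open>Red comes first in each pattern, and red heavy first in each superperiod
  (\<open>heavy_antimono\<close>): the hypothesis of \<open>run_index_mono\<close>.\<close>

lemma col_antimono:
  assumes "t \<le> t'" "t div per i = t' div per i" "col i t'"
  shows "col i t"
proof -
  have "t mod per i \<le> t' mod per i"
    using assms(1,2) by (simp add: modulo_nat_def)
  then show ?thesis
    using assms(2,3) by (simp add: col_def heavy_def)
qed

lemma heavy_antimono:
  assumes "t \<le> t'" "t div superper i = t' div superper i" "heavy i t'"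
  shows "heavy i t"
proof -
  have "t div per i mod (n * reps i) \<le> t' div per i mod (n * reps i)"
    using assms(1,2) div_le_mono[of t t' "per i"]
    by (simp add: modulo_nat_def superper_def div_mult2_eq)
  then show ?thesis
    using assms(3) by (simp add: heavy_def)
qed

lemma card_mod_less:
  assumes "m \<le> P"
  shows "card {t\<in>{..<P}. (t mod P < m) = b} = (if b then m else P - m)"
proof -
  have "{t\<in>{..<P}. (t mod P < m) = b} = (if b then {..<m} else {m..<P})"
    using assms by auto
  then show ?thesis
    by simp
qed

lemma card_short_period:
  "card {t\<in>{..<per i}. (t mod per i < reds h * n ^ i) = b} = (if b then reds h else n - reds h) * n ^ i"
  using card_mod_less[of "reds h * n ^ i" "per i" b] reds_le[of h]
  by (simp add: per_def diff_mult_distrib)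

text \<open>A superperiod is cut at the end of its red heavy part, and whole patterns are counted on
  each side.\<close>

lemma card_col_superper: "card {t\<in>{..<superper i}. col i t = b} \<le> density n a u b * superper i"
proof -
  let ?N = "\<lambda>h. if b then reds h else n - reds h"
  let ?m = "u * reps i" and ?m' = "(n - u) * reps i"
  let ?S = "\<lambda>h x m. {t\<in>{x..<x + m * per i}. (t mod per i < reds h * n ^ i) = b}"
  have len: "superper i = ?m * per i + ?m' * per i"
    using u by (simp add: superper_def flip: add_mult_distrib)
  have hv: "heavy i t \<longleftrightarrow> t < ?m * per i" if "t < superper i" for t
  proof -
    have "t div per i < n * reps i"
      using that per_pos by (simp add: superper_def less_mult_imp_div_less mult.commute)
    then show ?thesis
      using per_pos by (simp add: heavy_def div_less_iff_less_mult)
  qed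
  have "{t\<in>{..<superper i}. col i t = b} \<subseteq> ?S True 0 ?m \<union> ?S False (?m * per i) ?m'"
  proof
    fix t assume "t \<in> {t\<in>{..<superper i}. col i t = b}"
    then have "t < superper i" "(t mod per i < reds (t < ?m * per i) * n ^ i) = b"
      using hv[of t] by (simp_all add: col_def)
    then show "t \<in> ?S True 0 ?m \<union> ?S False (?m * per i) ?m'"
      using len by (cases "t < ?m * per i") simp_all
  qed
  then have "card {t\<in>{..<superper i}. col i t = b} \<le> card (?S True 0 ?m \<union> ?S False (?m * per i) ?m')"
    by (rule card_mono[rotated]) simp
  also have "\<dots> \<le> card (?S True 0 ?m) + card (?S False (?m * per i) ?m')"
    by (rule card_Un_le)
  also have "\<dots> \<le> ?m * (?N True * n ^ i) + ?m' * (?N False * n ^ i)"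
    unfolding card_short_period[symmetric]
    by (intro add_mono card_periodic_le per_pos) auto
  also have "\<dots> = (u * ?N True + (n - u) * ?N False) * (reps i * n ^ i)"
    by (simp add: algebra_simps)
  finally have "real (card {t\<in>{..<superper i}. col i t = b})
      \<le> real (u * ?N True + (n - u) * ?N False) * real (reps i * n ^ i)"
    by (metis of_nat_le_iff of_nat_mult)
  also have "real (u * ?N True + (n - u) * ?N False) = density n a u b * (real n)\<^sup>2"
    using n a by (simp add: reds_def density_def)
  finally show ?thesis
    by (simp add: superper_def per_def power2_eq_square mult_ac)
qed

lemma col_mod_superper: "col j (t mod superper j) = col j t"
proof -
      have "t mod superper j mod per j = t mod per j"
        by (simp add: superper_def mod_mult2_eq)
      moreover have "t mod superper j div per j mod (n * reps j) = t div per j mod (n * reps j)"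
      proof -
        have "t mod (p * K) div p mod K = t div p mod K" if "p > 0" for p K
          using that by (simp add: mod_mult2_eq)
        then show ?thesis
          unfolding superper_def using per_pos .
      qed
      ultimately show ?thesis
        by (simp add: col_def heavy_def)
    qed

section \<open>Edge bounds for one piece and for one pair of sections\<close>

lemma card_le_extent:
  fixes \<kappa> :: real
  assumes "finite S" "P > 0" "\<And>t. A (t mod P) = A t"
    and "card {t\<in>{..<P}. A t} \<le> \<kappa> * real P" and "\<And>t. t \<in> S \<Longrightarrow> A t"
  shows "card S \<le> \<kappa> * (extent S + P)"
proof (cases "S = {}")
  case True
  have "0 \<le> \<kappa> * real P"
    using assms(4) by (rule order_trans[OF of_nat_0_le_iff])
  with True show ?thesis
    by (simp add: extent_def range_hull_def)
next
  case False
  have "card S \<le> card {t\<in>{Min S..<Min S + extent S}. A t}"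
    using subset_range_hull[of S] range_hull_eq_interval[OF assms(1) False] assms(5)
    by (intro card_mono) auto
  also have "real \<dots> \<le> \<kappa> * (extent S + P)"
    by (rule card_periodic_le_real[OF assms(2,3,4)])
  finally show ?thesis
    by simp
qed

text \<open>Section \<open>i\<close> has the shorter runs and the longer pieces. Edges are grouped
  by the runs of section \<open>j\<close>, so each group uses a single colour in section
  \<open>i\<close>; \<open>s\<close> says whether matched colours agree. Light groups are paid for
  by section \<open>i\<close> alone, the excess of heavy groups by the colour share in section
  \<open>j\<close>.\<close>

lemma card_piece_le:
  assumes M: "finite M" "nested M" and ij: "i < j" "j < n"
    and match: "\<And>e. e \<in> M \<Longrightarrow> (col i (fst e) = col j (snd e)) = s"
    and piece: "\<And>e. e \<in> M \<Longrightarrow> heavy i (fst e) = h"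
  shows "card M \<le> \<rho> * extent (fst ` M) + (2 / n + \<rho>) * extent (snd ` M) + (4 * per i + superper j)"
proof -
  \<comment> \<open>\<open>\<mu> * (1 - \<tau>) = \<tau>\<close>, so the fraction
    \<open>\<mu>\<close> of the heavy edges costs only the light share of their interval.\<close>
  define \<tau> \<mu> where "\<tau> = a / n" and "\<mu> = \<tau> / (1 - \<tau>)"
  have \<tau>: "0 \<le> \<tau>" "\<tau> \<le> 1 / 2" "\<tau> * n = a"
    using a n by (simp_all add: \<tau>_def field_simps flip: of_nat_mult)
  have \<mu>: "0 \<le> \<mu>" "\<mu> * (1 - \<tau>) = \<tau>" "1 - \<mu> = (1 - 2 * \<tau>) / (1 - \<tau>)"
    using \<tau> by (simp_all add: \<mu>_def field_simps)
  \<comment> \<open>Negated because right ends decrease as left ends increase.\<close>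
  define key where "key e = - int (run_index (per j) (col j) (snd e))" for e :: "nat \<times> nat"
  define B where "B e \<longleftrightarrow> col i (fst e) = h" for e :: "nat \<times> nat"
  have "card M \<le> \<tau> * extent (fst ` M) + 0 * real (extent (snd ` M)) + real (per i) * card (key ` M) +
      (1 - \<mu>) * card {e\<in>M. B e}"
  proof (rule nested_card_le[OF M])
    fix e f assume "e \<in> M" "f \<in> M" "fst e < fst f"
    then have "snd f \<le> snd e"
      using M(2) unfolding nested_def by force
    then show "key e \<le> key f"
      using run_index_mono[of "per j" "col j", OF col_antimono] by (simp add: key_def)
  next
    fix k assume "k \<in> key ` M"
    then obtain e0 where e0: "e0 \<in> M" "key e0 = k"
      by blast
    define b where "b = col i (fst e0)"
    let ?C = "{e\<in>M. key e = k}"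
    \<comment> \<open>Inside a piece the pattern is fixed, so this condition of period
      \<open>per i\<close> describes colour \<open>b\<close> there.\<close>
    let ?A = "\<lambda>t. (t mod per i < reds h * n ^ i) = b"
    have col: "col i (fst e) = b" if "e \<in> ?C" for e
      using that e0 match[of e] match[of e0] run_index_eqD[of "per j" "col j" "snd e" "snd e0"]
      by (auto simp: key_def b_def)
    have "real (card {t\<in>{..<per i}. ?A t}) = (if b = h then 1 - \<tau> else \<tau>) * per i"
      unfolding card_short_period using a n
      by (auto simp: reds_def \<tau>_def per_def of_nat_diff field_simps)
    moreover have "?A t" if "t \<in> fst ` ?C" for t
      using that col piece by (auto simp: col_def)
    moreover have "card (fst ` ?C) = card ?C"
      by (intro card_image inj_on_subset[OF nested_inj_on(1)[OF M(2)]]) auto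
    ultimately have le: "card ?C \<le> (if b = h then 1 - \<tau> else \<tau>) * (extent (fst ` ?C) + per i)"
      using card_le_extent[of "fst ` ?C" "per i" ?A "if b = h then 1 - \<tau> else \<tau>"] M(1) per_pos
      by simp
    have \<tau>per: "\<tau> * per i \<le> per i"
      using \<tau> by (simp add: mult_left_le_one_le)
    show "card ?C \<le> \<tau> * extent (fst ` ?C) + 0 * real (extent (snd ` ?C)) + per i +
        (1 - \<mu>) * card {e\<in>M. key e = k \<and> B e}"
    proof (cases "b = h")
      \<comment> \<open>Heavy group: the \<open>\<mu>\<close> part of the edges is bounded here, the
        \<open>1 - \<mu>\<close> part is kept for the count over all groups.\<close>
      case True
      then have "{e\<in>M. key e = k \<and> B e} = ?C"
        using col by (auto simp: B_def)
      moreover have "\<mu> * card ?C \<le> \<mu> * ((1 - \<tau>) * (extent (fst ` ?C) + per i))"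
        using le True by (intro mult_left_mono \<mu>) simp
      moreover have "\<dots> = \<tau> * (extent (fst ` ?C) + per i)"
        by (simp only: mult.assoc[symmetric] \<mu>(2))
      ultimately show ?thesis
        using \<tau>per by (simp add: algebra_simps)
    next
      case False
      then have empty: "{e\<in>M. key e = k \<and> B e} = {}"
        using col by (auto simp: B_def)
      show ?thesis
        unfolding empty using le False \<tau>per by (simp add: algebra_simps)
    qed
  qed (use \<tau> in auto)
  \<comment> \<open>Each group costs an error \<open>per i\<close>, but there are only about two
    groups per \<open>per j\<close> positions, and \<open>per i / per j \<le> 1 / n\<close>.\<close>
  moreover have "card (key ` M) \<le> 2 * (extent (snd ` M) / per j) + 4"
  proof -
    have "key ` M = (\<lambda>x. - int x) ` run_index (per j) (col j) ` snd ` M"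
      by (auto simp: key_def)
    then have "card (key ` M) = card (run_index (per j) (col j) ` snd ` M)"
      by (simp add: card_image inj_on_def)
    then show ?thesis
      using card_run_index_le[OF per_pos, of "snd ` M" j "col j"] M(1) by simp
  qed
  then have "real (per i) * card (key ` M) \<le> real (per i) * (2 * (extent (snd ` M) / per j) + 4)"
    by (intro mult_left_mono) auto
  moreover have "real (per i) * (2 * (extent (snd ` M) / per j)) \<le> 2 / n * extent (snd ` M)"
  proof -
    have "real n * real (per i) \<le> real (per j)"
      using per_le[OF ij(1)] by (metis of_nat_le_iff of_nat_mult)
    then have "real (per i) / per j \<le> 1 / n"
      using n per_pos[of j] by (simp add: field_simps)
    from mult_right_mono[OF this, of "2 * extent (snd ` M)"] show ?thesis
      by (simp add: field_simps)
  qed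
  \<comment> \<open>All heavy edges have the same colour, \<open>h = s\<close>, at their end in
    section \<open>j\<close>, so the overall share \<open>D\<close> applies to them.\<close>
  moreover have "(1 - \<mu>) * card {e\<in>M. B e} \<le> \<rho> * extent (snd ` M) + superper j"
  proof -
    let ?E = "{e\<in>M. B e}"
    let ?A = "\<lambda>t. col j t = (h = s)"
    have card_le: "card {t\<in>{..<superper j}. ?A t} \<le> D * superper j"
      using card_col_superper[of j "h = s"] mult_right_mono[OF density_le[of "h = s"], of "superper j"]
      by simp
    have "?A t" if "t \<in> snd ` ?E" for t
      using that match by (auto simp: B_def)
    then have "card (snd ` ?E) \<le> D * (extent (snd ` ?E) + superper j)"
      using M(1) by (intro card_le_extent[OF _ superper_pos _ card_le]) (auto simp: col_mod_superper)
    also have "\<dots> \<le> D * (extent (snd ` M) + superper j)"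
    proof -
      have "0 \<le> density n a u True"
        by (simp add: density_def)
      then have "D \<ge> 0"
        using density_le[of True] by linarith
      moreover have "extent (snd ` ?E) \<le> extent (snd ` M)"
        using M(1) by (intro extent_mono) auto
      ultimately show ?thesis
        by (intro mult_left_mono) auto
    qed
    also have "card (snd ` ?E) = card ?E"
      by (intro card_image inj_on_subset[OF nested_inj_on(2)[OF M(2)]]) auto
    finally have "(1 - \<mu>) * card ?E \<le> (1 - \<mu>) * (D * (extent (snd ` M) + superper j))"
      using \<mu>(3) \<tau> by (intro mult_left_mono) auto
    also have "\<dots> = ((1 - \<mu>) * D) * (extent (snd ` M) + superper j)"
      by simp
    \<comment> \<open>This is \<open>rho(3)\<close> divided by \<open>1 - \<tau>\<close>.\<close>
    also have "(1 - \<mu>) * D \<le> \<rho>"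
      using rho(3) \<tau> unfolding \<mu>(3) \<tau>_def[symmetric] by (simp add: field_simps)
    finally have "(1 - \<mu>) * card ?E \<le> \<rho> * (extent (snd ` M) + superper j)"
      by (simp add: mult_right_mono)
    then show ?thesis
      using mult_right_mono[OF rho(2), of "superper j"] by (simp add: algebra_simps)
  qed
  moreover have "\<tau> * extent (fst ` M) \<le> \<rho> * extent (fst ` M)"
    using rho(1) by (intro mult_right_mono) (simp_all add: \<tau>_def)
  ultimately show ?thesis
    by (simp add: algebra_simps)
qed

text \<open>Section \<open>i\<close> is cut into its pieces. Each costs an error of at most
  \<open>5 * superper j\<close>, and there are about two per \<open>superper i\<close>, so the
  errors add up to a \<open>10 / n\<close> share plus a term depending on \<open>n\<close>
  only.\<close>

lemma card_pair_le:
  assumes M: "finite M" "nested M" and ij: "i < j" "j < n"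
    and match: "\<And>e. e \<in> M \<Longrightarrow> (col i (fst e) = col j (snd e)) = s"
  shows "card M \<le> (\<rho> + 10 / n) * (extent (fst ` M) + extent (snd ` M)) + 20 * n ^ (2 * n + 2)"
proof -
  define key where "key e = int (run_index (superper i) (heavy i) (fst e))" for e :: "nat \<times> nat"
  define \<gamma> where "\<gamma> = real (4 * per i + superper j)"
  have "\<rho> \<ge> 0"
    using rho(1) by (rule order_trans[rotated]) simp
  have "card M \<le> \<rho> * extent (fst ` M) + (2 / n + \<rho>) * extent (snd ` M) + \<gamma> * card (key ` M) +
      0 * real (card {e\<in>M. True})"
  proof (rule nested_card_le[OF M])
    fix e f assume "e \<in> M" "f \<in> M" "fst e < fst f"
    then show "key e \<le> key f"
      using run_index_mono[of "superper i" "heavy i", OF heavy_antimono] by (simp add: key_def)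
  next
    fix k assume "k \<in> key ` M"
    then obtain e0 where e0: "e0 \<in> M" "key e0 = k"
      by blast
    let ?C = "{e\<in>M. key e = k}"
    have "heavy i (fst e) = heavy i (fst e0)" if "e \<in> ?C" for e
      using that e0 run_index_eqD[of "superper i" "heavy i" "fst e" "fst e0"] by (simp add: key_def)
    moreover have "nested ?C"
      using M(2) by (rule nested_subset) auto
    ultimately show "card ?C \<le> \<rho> * extent (fst ` ?C) + (2 / n + \<rho>) * extent (snd ` ?C) + \<gamma> +
        0 * real (card {e\<in>M. key e = k \<and> True})"
      using card_piece_le[of ?C i j s "heavy i (fst e0)"] M(1) ij match by (simp add: \<gamma>_def)
  qed (use \<open>\<rho> \<ge> 0\<close> in auto)
  moreover have "\<gamma> * card (key ` M) \<le> 10 / n * extent (fst ` M) + 20 * n ^ (2 * n + 2)"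
  proof -
    let ?e = "real (extent (fst ` M))"
    have "key ` M = int ` run_index (superper i) (heavy i) ` fst ` M"
      by (auto simp: key_def)
    then have "card (key ` M) = card (run_index (superper i) (heavy i) ` fst ` M)"
      by (simp add: card_image)
    then have "card (key ` M) \<le> 2 * (?e / superper i) + 4"
      using card_run_index_le[OF superper_pos, of "fst ` M" i "heavy i"] M(1) by simp
    moreover have "\<gamma> \<le> 5 * superper j"
      using per_le_superper[of i j] ij unfolding \<gamma>_def by (simp flip: of_nat_mult of_nat_add)
    ultimately have "\<gamma> * card (key ` M) \<le> 5 * superper j * (2 * (?e / superper i) + 4)"
      by (intro mult_mono) auto
    also have "\<dots> = 10 * ?e * (superper j / superper i) + 20 * real (superper j)"
      by (simp add: algebra_simps)
    also have "\<dots> \<le> 10 * ?e * (1 / n) + 20 * real (n ^ (2 * n + 2))"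
    proof (intro add_mono mult_left_mono)
      have "real n * real (superper j) \<le> real (superper i)"
        using superper_le[OF ij(1)] ij by (metis of_nat_le_iff of_nat_mult less_imp_le)
      then show "real (superper j) / superper i \<le> 1 / n"
        using n superper_pos[of i] by (simp add: field_simps)
      show "real (superper j) \<le> real (n ^ (2 * n + 2))"
        using ij by (intro of_nat_mono superper_le_max) simp
    qed auto
    finally show ?thesis
      by simp
  qed
  moreover have "2 / n * extent (snd ` M) \<le> 10 / n * extent (snd ` M)"
    by (intro mult_right_mono divide_right_mono) auto
  ultimately show ?thesis
    by (simp add: algebra_simps)
qed

end

section \<open>Unfolding a proper matching\<close>

text \<open>Turns the modular arc into an ordinary interval of rotated positions, through which
  cross-freeness becomes nesting.\<close>

lemma arc_between_rotated:
  assumes "\<alpha> < \<beta>" "\<beta> < N"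
  shows "arc_between N ((s + \<alpha>) mod N) ((s + \<beta>) mod N) = (\<lambda>k. (s + k) mod N) ` {\<alpha><..<\<beta>}"
proof -
  \<comment> \<open>Computed over \<open>int\<close>, where truncated subtraction does not interfere
    with reduction modulo \<open>N\<close>.\<close>
  have "int (((s + \<beta>) mod N + N - (s + \<alpha>) mod N) mod N) =
      (int ((s + \<beta>) mod N) + int N - int ((s + \<alpha>) mod N)) mod int N"
    using assms mod_less_divisor[of N "s + \<alpha>"] by (simp add: of_nat_mod of_nat_diff less_imp_le trans_le_add2)
  also have "\<dots> = (int ((s + \<beta>) mod N) - int ((s + \<alpha>) mod N) + int N) mod int N"
    by (simp add: algebra_simps)
  also have "\<dots> = (int ((s + \<beta>) mod N) - int ((s + \<alpha>) mod N)) mod int N"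
    by (rule mod_add_self2)
  also have "\<dots> = (int \<beta> - int \<alpha>) mod int N"
    by (simp add: of_nat_mod mod_diff_eq)
  also have "\<dots> = int (\<beta> - \<alpha>)"
    using assms by (simp add: of_nat_diff)
  finally have "((s + \<beta>) mod N + N - (s + \<alpha>) mod N) mod N = \<beta> - \<alpha>"
    by simp
  moreover have "((s + \<alpha>) mod N + k) mod N = (s + (\<alpha> + k)) mod N" for k
    by (simp add: mod_simps add.assoc)
  moreover have "{\<alpha><..<\<beta>} = (\<lambda>k. \<alpha> + k) ` {0<..<\<beta> - \<alpha>}"
    using assms by (force intro: image_eqI[of _ _ "_ - \<alpha>"])
  ultimately show ?thesis
    by (simp add: arc_between_def image_image)
qed

lemma inj_on_rotate: "inj_on (\<lambda>k. (s + k) mod N) {..<N::nat}"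
proof (rule linorder_inj_onI')
  fix k k' assume *: "k \<in> {..<N}" "k' \<in> {..<N}" "k < k'"
  then have "\<not> N dvd (s + k') - (s + k)"
    by (intro nat_dvd_not_less) auto
  then show "(s + k) mod N \<noteq> (s + k') mod N"
    using *(3) by (metis mod_eq_dvd_iff_nat less_imp_le_nat nat_add_left_cancel_le)
qed

text \<open>Rotate so that the first arc becomes \<open>{..<l}\<close>, and order each edge by its
  ends in the first and the second arc.\<close>

lemma proper_matching_nested:
  assumes "matching N M" "proper N M"
  obtains s l X where "l \<le> N" "finite X" "nested X" "card X = card M"
    "\<And>e. e \<in> X \<Longrightarrow> fst e < l \<and> l \<le> snd e \<and> snd e < N \<and>
       {(s + fst e) mod N, (s + snd e) mod N} \<in> M"
proof (cases "N = 0")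
  case True
  then have "M = {}"
    using assms(1) by (fastforce simp: matching_def)
  then show ?thesis
    using that[of 0 "{}"] by (simp add: nested_def)
next
  case False
  obtain A1 A2 where sec: "secant N A1 A2" "secant_respecting A1 A2 M"
    using assms(2) by (auto simp: proper_def)
  then obtain s l where l: "l \<le> N" and A1: "A1 = (\<lambda>k. (s + k) mod N) ` {..<l}"
    by (auto simp: secant_def contiguous_arc_def)
  define pos where "pos k = (s + k) mod N" for k
  have inj: "inj_on pos {..<N}"
    unfolding pos_def by (rule inj_on_rotate)
  have "pos ` {..<N} = {..<N}"
  proof (intro card_subset_eq)
    show "pos ` {..<N} \<subseteq> {..<N}"
      using False by (auto simp: pos_def)
  qed (simp_all add: card_image[OF inj])
  moreover have "{..<N} = {..<l} \<union> {l..<N}"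
    using l by auto
  moreover have "A1 = pos ` {..<l}"
    by (simp add: A1 pos_def)
  ultimately have "{..<N} = A1 \<union> pos ` {l..<N}"
    by (metis image_Un)
  then have A2: "A2 \<subseteq> pos ` {l..<N}"
    using sec(1) unfolding secant_def by blast
  define X where "X = {(\<alpha>, \<beta>). \<alpha> < l \<and> l \<le> \<beta> \<and> \<beta> < N \<and> {pos \<alpha>, pos \<beta>} \<in> M}"
  have pos_eq: "pos k = pos k' \<longleftrightarrow> k = k'" if "k < N" "k' < N" for k k'
    using inj that by (auto simp: inj_on_eq_iff)
  have "X \<subseteq> {..<N} \<times> {..<N}"
    using l by (auto simp: X_def)
  then have "finite X"
    by (rule finite_subset) simp
  moreover have "card X = card M"
  proof (rule bij_betw_same_card)
    show "bij_betw (\<lambda>e. {pos (fst e), pos (snd e)}) X M"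
      unfolding bij_betw_def
    proof
      show "inj_on (\<lambda>e. {pos (fst e), pos (snd e)}) X"
        using l by (auto simp: inj_on_def X_def doubleton_eq_iff pos_eq)
      show "(\<lambda>e. {pos (fst e), pos (snd e)}) ` X = M"
      proof (intro equalityI subsetI)
        fix e assume "e \<in> M"
        with sec(2) obtain x y where xy: "x \<in> A1" "y \<in> A2" "e = {x, y}"
          by (auto simp: secant_respecting_def)
        from xy(1) obtain \<alpha> where \<alpha>: "\<alpha> < l" "x = pos \<alpha>"
          by (auto simp: A1 pos_def)
        from xy(2) A2 have "y \<in> pos ` {l..<N}"
          by blast
        then obtain \<beta> where "l \<le> \<beta>" "\<beta> < N" "y = pos \<beta>"
          by auto
        with xy(3) \<alpha> have "\<alpha> < l" "l \<le> \<beta>" "\<beta> < N" "e = {pos \<alpha>, pos \<beta>}"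
          by simp_all
        with \<open>e \<in> M\<close> show "e \<in> (\<lambda>e. {pos (fst e), pos (snd e)}) ` X"
          by (intro image_eqI[of _ _ "(\<alpha>, \<beta>)"]) (auto simp: X_def)
      qed (auto simp: X_def)
    qed
  qed
  moreover have "nested X"
    unfolding nested_def
  proof (intro ballI)
    fix e f assume "e \<in> X" "f \<in> X"
    obtain \<alpha> \<beta> \<gamma> \<delta> where ef: "e = (\<alpha>, \<beta>)" "f = (\<gamma>, \<delta>)"
      by (metis surj_pair)
    have *: "\<alpha> < l" "l \<le> \<beta>" "\<beta> < N" "\<gamma> < l" "l \<le> \<delta>" "\<delta> < N" and
      M: "{pos \<alpha>, pos \<beta>} \<in> M" "{pos \<gamma>, pos \<delta>} \<in> M"
      using \<open>e \<in> X\<close> \<open>f \<in> X\<close> by (auto simp: X_def ef)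
    show "e = f \<or> fst e < fst f \<and> snd f < snd e \<or> fst f < fst e \<and> snd e < snd f"
    proof (cases "e = f")
      case False
      then have ne: "{pos \<alpha>, pos \<beta>} \<noteq> {pos \<gamma>, pos \<delta>}"
        using * l by (auto simp: doubleton_eq_iff pos_eq ef)
      then have "{pos \<alpha>, pos \<beta>} \<inter> {pos \<gamma>, pos \<delta>} = {}"
        using assms(1) M by (simp add: matching_def)
      then have dis: "\<alpha> \<noteq> \<gamma>" "\<beta> \<noteq> \<delta>"
        by auto
      have "arc_between N (pos \<alpha>) (pos \<beta>) = pos ` {\<alpha><..<\<beta>}"
        using arc_between_rotated[of \<alpha> \<beta> N s] * by (simp add: pos_def)
      moreover have "pos k \<in> pos ` {\<alpha><..<\<beta>} \<longleftrightarrow> k \<in> {\<alpha><..<\<beta>}" if "k < N" for k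
        using that * by (intro inj_on_image_mem_iff[OF inj]) auto
      moreover have "{pos \<gamma>, pos \<delta>} \<inter> arc_between N (pos \<alpha>) (pos \<beta>) = {} \<or>
          {pos \<gamma>, pos \<delta>} \<subseteq> arc_between N (pos \<alpha>) (pos \<beta>)"
      proof -
        have "cross_free N M"
          using assms(2) by (simp add: proper_def)
        from this[unfolded cross_free_def, rule_format, OF M ne] show ?thesis
          by blast
      qed
      \<comment> \<open>As \<open>\<gamma> < l \<le> \<beta>\<close> and
        \<open>\<alpha> < l \<le> \<delta>\<close>, this says that
        \<open>\<alpha> < \<gamma>\<close> iff \<open>\<delta> < \<beta>\<close>.\<close>
      ultimately have "\<gamma> \<in> {\<alpha><..<\<beta>} \<longleftrightarrow> \<delta> \<in> {\<alpha><..<\<beta>}"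
        using * l by auto
      then show ?thesis
        using dis * by (auto simp: ef)
    qed simp
  qed
  ultimately show ?thesis
    using that[of l X s] l by (auto simp: X_def pos_def)
qed

section \<open>Matchings of the whole necklace\<close>

text \<open>\<open>f\<close> is a translation by \<open>s - o'\<close>, of either sign, hence the
  form with sums. It passes from unrolled positions to offsets inside a section.\<close>

lemma extent_shift_le:
  assumes "finite S" and f: "\<And>x. x \<in> S \<Longrightarrow> f x + o' = x + s"
  shows "extent (f ` S) \<le> extent S"
  unfolding extent_def
proof (rule card_inj_on_le[where f = "\<lambda>y. y + o' - s"])
  have ge: "s \<le> y + o'" if "y \<in> range_hull (f ` S)" for y
  proof -
    from that obtain x where "x \<in> S" "f x \<le> y"
      by (auto simp: range_hull_def)
    with f[of x] show ?thesis
      by linarith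
  qed
  show "inj_on (\<lambda>y. y + o' - s) (range_hull (f ` S))"
  proof (rule inj_onI)
    fix y z assume "y \<in> range_hull (f ` S)" "z \<in> range_hull (f ` S)" "y + o' - s = z + o' - s"
    with ge[of y] ge[of z] show "y = z"
      by linarith
  qed
  show "(\<lambda>y. y + o' - s) ` range_hull (f ` S) \<subseteq> range_hull S"
  proof
    fix z assume "z \<in> (\<lambda>y. y + o' - s) ` range_hull (f ` S)"
    then obtain y x x' where "z = y + o' - s" and x: "x \<in> S" "x' \<in> S" "f x \<le> y" "y \<le> f x'"
      by (auto simp: range_hull_def)
    then have "x \<le> z" "z \<le> x'"
      using f[of x] f[of x'] by linarith+
    with x show "z \<in> range_hull S"
      by (auto simp: range_hull_def)
  qed
qed (rule finite_range_hull[OF assms(1)])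

text \<open>The two ends may lie in different sections, so each has its own offset.\<close>

lemma nested_shift:
  assumes "nested M" and g: "\<And>e. e \<in> M \<Longrightarrow> fst (g e) + o1 = fst e + s \<and> snd (g e) + o2 = snd e + s"
  shows "nested (g ` M)" "inj_on g M"
proof -
  show "inj_on g M"
    by (rule inj_onI) (metis g add_right_cancel prod_eq_iff)
  show "nested (g ` M)"
    unfolding nested_def
  proof (intro ballI, elim imageE, hypsubst)
    fix e f assume ef: "e \<in> M" "f \<in> M"
    then have "e = f \<or> fst e < fst f \<and> snd f < snd e \<or> fst f < fst e \<and> snd e < snd f"
      using assms(1) unfolding nested_def by blast
    then show "g e = g f \<or> fst (g e) < fst (g f) \<and> snd (g f) < snd (g e) \<or>
        fst (g f) < fst (g e) \<and> snd (g e) < snd (g f)"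
      using g[OF ef(1)] g[OF ef(2)] by (elim disjE conjE) (simp, linarith, linarith)
  qed
qed

context multiscale
begin

text \<open>After \<open>n\<close> sections of width \<open>w\<close> comes padding:
  \<open>r\<close> red beads, then blue ones. The choice of \<open>r\<close> adjusts the number of
  red beads.\<close>

definition bead :: "nat \<Rightarrow> nat \<Rightarrow> nat \<Rightarrow> bool" where
  "bead w r x = (if x < n * w then col (x div w) (x mod w) else x < n * w + r)"

text \<open>Nesting is symmetric in the two arcs, so the section with the shorter runs may lie on
  either side of the secant.\<close>

lemma card_pair_le':
  assumes M: "finite M" "nested M" and ij: "i \<noteq> j" "i < n" "j < n"
    and match: "\<And>e. e \<in> M \<Longrightarrow> (col i (fst e) = col j (snd e)) = v"
  shows "card M \<le> (\<rho> + 10 / n) * (extent (fst ` M) + extent (snd ` M)) + 20 * n ^ (2 * n + 2)"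
proof (cases "i < j")
  case False
  then have "j < i"
    using ij by simp
  moreover have "(col j (fst e) = col i (snd e)) = v" if "e \<in> prod.swap ` M" for e
  proof -
    from that obtain e0 where "e0 \<in> M" "e = prod.swap e0"
      by blast
    then show ?thesis
      using match[of e0] by auto
  qed
  moreover have "card (prod.swap ` M) = card M"
    by (simp add: card_image)
  ultimately show ?thesis
    using card_pair_le[of "prod.swap ` M" j i v] M ij nested_swap[OF M(2)]
    by (simp add: image_image add.commute)
qed (use card_pair_le[OF M] assms in blast)

text \<open>Positions are unrolled: \<open>y\<close> and \<open>y + N\<close> are the same bead, but have different section
  indices. The index \<open>n\<close> modulo \<open>n + 1\<close> marks the padding beyond the \<open>n\<close> sections.\<close>

definition section_index :: "nat \<Rightarrow> nat \<Rightarrow> nat \<Rightarrow> nat" where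
  "section_index N w y = (y div N) * (n + 1) + (if y mod N < n * w then y mod N div w else n)"

lemma section_index_mono:
  assumes "N > 0" "w > 0" "y \<le> z"
  shows "section_index N w y \<le> section_index N w z"
proof (cases "y div N = z div N")
  case True
  then have "y mod N \<le> z mod N"
    using assms(3) by (simp add: modulo_nat_def)
  moreover have "y mod N div w \<le> n" if "y mod N < n * w"
    using that by (simp add: less_imp_le less_mult_imp_div_less)
  ultimately show ?thesis
    using True by (auto simp: section_index_def div_le_mono)
next
  case False
  have "section_index N w y < (y div N + 1) * (n + 1)"
    by (auto simp: section_index_def less_mult_imp_div_less less_Suc_eq)
  also have "\<dots> \<le> (z div N) * (n + 1)"
    using False div_le_mono[OF assms(3), of N] by (intro mult_le_mono1) simp
  finally show ?thesis
    by (simp add: section_index_def)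
qed

lemma section_index_divmod:
  assumes "y mod N < n * w"
  shows "section_index N w y div (n + 1) = y div N"
    and "section_index N w y mod (n + 1) = y mod N div w"
    and "y mod N div w < n"
proof -
  show *: "y mod N div w < n"
    using assms by (rule less_mult_imp_div_less)
  show "section_index N w y div (n + 1) = y div N"
    "section_index N w y mod (n + 1) = y mod N div w"
    using assms * by (simp_all add: section_index_def mult.commute[of _ "n + 1"] del: mult_Suc mult_Suc_right)
qed

lemma section_index_period: "N > 0 \<Longrightarrow> section_index N w (y + N) = section_index N w y + (n + 1)"
  by (simp add: section_index_def)

text \<open>On all positions with one unrolled section index, passing to the offset inside the
  section is one and the same translation.\<close>

lemma bead_decomp:
  assumes "y mod N < n * w"
  defines "A \<equiv> section_index N w y"
  shows "y = N * (A div (n + 1)) + w * (A mod (n + 1)) + y mod N mod w"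
    and "bead w r (y mod N) = col (A mod (n + 1)) (y mod N mod w)"
proof -
  have "y = N * (y div N) + (w * (y mod N div w) + y mod N mod w)"
    by simp
  then show "y = N * (A div (n + 1)) + w * (A mod (n + 1)) + y mod N mod w"
    unfolding A_def section_index_divmod[OF assms(1)] by linarith
  show "bead w r (y mod N) = col (A mod (n + 1)) (y mod N mod w)"
    unfolding A_def section_index_divmod[OF assms(1)] using assms(1) by (simp add: bead_def)
qed

lemma card_section_le:
  assumes "w > 0" "finite S"
    and S: "\<And>x. x \<in> S \<Longrightarrow> (s + x) mod N < n * w \<and> section_index N w (s + x) = c"
  shows "card S \<le> w"
proof -
  have "inj_on (\<lambda>x. (s + x) mod N mod w) S"
  proof (rule inj_onI)
    fix x y assume "x \<in> S" "y \<in> S" "(s + x) mod N mod w = (s + y) mod N mod w"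
    with bead_decomp(1)[of "s + x" N w] bead_decomp(1)[of "s + y" N w] S[of x] S[of y]
    have "s + x = s + y"
      by metis
    then show "x = y"
      by simp
  qed
  then have "card S \<le> card {..<w}"
    using assms(1) by (intro card_inj_on_le) auto
  then show ?thesis
    by simp
qed

text \<open>Edges between different sections (\<open>G\<close>) are grouped by pairs of sections and
  bounded by \<open>card_pair_le'\<close>. Edges inside one section (\<open>H\<close>) and edges
  touching the padding are bounded by the number of available ends.\<close>

lemma card_nested_le:
  assumes X: "finite X" "nested X" and l: "l \<le> N" "N > 0" and w: "w > 0" "n * w \<le> N"
    and dom: "\<And>e. e \<in> X \<Longrightarrow> fst e < l \<and> l \<le> snd e \<and> snd e < N"
    and match: "\<And>e. e \<in> X \<Longrightarrow> (bead w r ((s + fst e) mod N) = bead w r ((s + snd e) mod N)) = v"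
  shows "card X \<le> (\<rho> + 10 / n) * N + real (20 * n ^ (2 * n + 2)) * real (n + 2) +
    2 * real (N - n * w) + 2 * real w"
proof -
  define \<sigma> where "\<sigma> x = section_index N w (s + x)" for x
  define inner where "inner x \<longleftrightarrow> (s + x) mod N < n * w" for x
  define G where "G = {e\<in>X. inner (fst e) \<and> inner (snd e) \<and> \<sigma> (fst e) mod (n + 1) \<noteq> \<sigma> (snd e) mod (n + 1)}"
  define H where "H = {e\<in>X. inner (fst e) \<and> inner (snd e) \<and> \<sigma> (fst e) mod (n + 1) = \<sigma> (snd e) mod (n + 1)}"
  have \<sigma>_mono: "\<sigma> x \<le> \<sigma> y" if "x \<le> y" for x y
    using that l w by (simp add: \<sigma>_def section_index_mono)
  have \<sigma>_period: "\<sigma> N = \<sigma> 0 + (n + 1)"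
    using l by (simp add: \<sigma>_def section_index_period)
  have X_bounds: "\<sigma> 0 \<le> \<sigma> (fst e)" "\<sigma> (fst e) \<le> \<sigma> l" "\<sigma> l \<le> \<sigma> (snd e)" "\<sigma> (snd e) \<le> \<sigma> 0 + (n + 1)"
    if "e \<in> X" for e
    using dom[OF that] \<sigma>_mono \<sigma>_period by (metis less_imp_le zero_le)+
  have inj: "card (fst ` Y) = card Y" "card (snd ` Y) = card Y" if "Y \<subseteq> X" for Y
    using nested_inj_on[OF X(2)] that by (auto intro: card_image inj_on_subset)

  have outer: "card {x\<in>{..<N}. \<not> inner x} \<le> N - n * w"
  proof -
    have "card {x\<in>{..<N}. \<not> inner x} \<le> card {n * w..<N}"
      by (rule card_inj_on_le[where f = "\<lambda>x. (s + x) mod N"])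
        (use l in \<open>auto simp: inner_def intro: inj_on_subset[OF inj_on_rotate]\<close>)
    then show ?thesis
      by simp
  qed
  have out1: "card {e\<in>X. \<not> inner (fst e)} \<le> N - n * w"
  proof -
    have "card (fst ` {e\<in>X. \<not> inner (fst e)}) \<le> card {x\<in>{..<N}. \<not> inner x}"
      using dom l by (intro card_mono) force+
    then show ?thesis
      using outer inj(1)[of "{e\<in>X. \<not> inner (fst e)}"] by simp
  qed
  have out2: "card {e\<in>X. \<not> inner (snd e)} \<le> N - n * w"
  proof -
    have "card (snd ` {e\<in>X. \<not> inner (snd e)}) \<le> card {x\<in>{..<N}. \<not> inner x}"
      using dom l by (intro card_mono) force+
    then show ?thesis
      using outer inj(2)[of "{e\<in>X. \<not> inner (snd e)}"] by simp
  qed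

  \<comment> \<open>An edge inside one section needs that section to contain an end of the secant.\<close>
  have H_le: "card H \<le> 2 * w"
  proof -
    let ?S = "\<lambda>c. {x\<in>fst ` X. inner x \<and> \<sigma> x = c}"
    have S_le: "card (?S c) \<le> w" for c
      using X(1) w by (intro card_section_le[of w _ s N c]) (auto simp: inner_def \<sigma>_def)
    have "fst ` H \<subseteq> ?S (\<sigma> 0) \<union> ?S (\<sigma> l)"
    proof
      fix x assume "x \<in> fst ` H"
      then obtain e where e: "e \<in> X" "inner x" "x = fst e" "\<sigma> (fst e) mod (n + 1) = \<sigma> (snd e) mod (n + 1)"
        by (auto simp: H_def)
      define d where "d = \<sigma> (snd e) - \<sigma> (fst e)"
      note b = X_bounds[OF e(1)]
      have "\<sigma> (fst e) \<le> \<sigma> (snd e)"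
        using b by linarith
      then have "n + 1 dvd d"
        using e(4) unfolding d_def by (metis mod_eq_dvd_iff_nat)
      moreover have "d \<le> n + 1"
        using b by (simp add: d_def)
      \<comment> \<open>\<open>d = 0\<close> puts both ends into the section of \<open>l\<close>;
        \<open>d = n + 1\<close>, a full turn, puts the left end into the section of position
        0.\<close>
      ultimately have "d = 0 \<or> d = n + 1"
        by (metis dvd_imp_le le_antisym not_gr_zero)
      then have "\<sigma> x = \<sigma> 0 \<or> \<sigma> x = \<sigma> l"
        using b e(3) by (auto simp: d_def)
      then show "x \<in> ?S (\<sigma> 0) \<union> ?S (\<sigma> l)"
        using e by auto
    qed
    then have "card (fst ` H) \<le> card (?S (\<sigma> 0) \<union> ?S (\<sigma> l))"
      using X(1) by (intro card_mono) auto
    also have "\<dots> \<le> card (?S (\<sigma> 0)) + card (?S (\<sigma> l))"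
      by (rule card_Un_le)
    finally show ?thesis
      using S_le[of "\<sigma> 0"] S_le[of "\<sigma> l"] inj(1)[of H] by (simp add: H_def)
  qed

  \<comment> \<open>Both summands are weakly increasing along left ends. Hence edges with equal key
    share both section indices, and there are at most \<open>n + 2\<close> keys rather than
    quadratically many.\<close>
  define key where "key e = int (\<sigma> (fst e)) - int (\<sigma> (snd e))" for e
  have G: "finite G" "nested G" "G \<subseteq> X"
    using X by (auto simp: G_def intro: nested_subset)
  have "\<rho> + 10 / n \<ge> 0"
    using rho(1) by (smt (verit) divide_nonneg_nonneg of_nat_0_le_iff)
  moreover have anti: "snd f \<le> snd e" if "e \<in> G" "f \<in> G" "fst e < fst f" for e f
    using that G(2) unfolding nested_def by force
  have "card G \<le> (\<rho> + 10 / n) * extent (fst ` G) + (\<rho> + 10 / n) * extent (snd ` G) +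
      real (20 * n ^ (2 * n + 2)) * card (key ` G) + 0 * real (card {e\<in>G. True})"
  proof (rule nested_card_le[OF G(1,2)])
    fix e f assume "e \<in> G" "f \<in> G" "fst e < fst f"
    then show "key e \<le> key f"
      using \<sigma>_mono[of "fst e" "fst f"] \<sigma>_mono[OF anti[of e f]] by (simp add: key_def)
  next
    fix k assume "k \<in> key ` G"
    then obtain e0 where e0: "e0 \<in> G" "key e0 = k"
      by blast
    let ?C = "{e\<in>G. key e = k}"
    have C: "finite ?C" "nested ?C"
      using G by (auto intro: nested_subset)
    define A where "A = \<sigma> (fst e0)"
    define B where "B = \<sigma> (snd e0)"
    have AB: "\<sigma> (fst e) = A \<and> \<sigma> (snd e) = B" if "e \<in> ?C" for e
    proof -
      have "e = e0 \<or> fst e < fst e0 \<and> snd e0 < snd e \<or> fst e0 < fst e \<and> snd e < snd e0"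
        using that e0 G(2) unfolding nested_def by blast
      moreover have "key e = key e0"
        using that e0 by simp
      ultimately show ?thesis
        unfolding A_def B_def key_def
        using \<sigma>_mono[of "fst e" "fst e0"] \<sigma>_mono[of "fst e0" "fst e"]
          \<sigma>_mono[of "snd e" "snd e0"] \<sigma>_mono[of "snd e0" "snd e"] by auto
    qed
    let ?i = "A mod (n + 1)" and ?j = "B mod (n + 1)"
    \<comment> \<open>The unrolled starting positions of the two sections.\<close>
    define o1 where "o1 = N * (A div (n + 1)) + w * ?i"
    define o2 where "o2 = N * (B div (n + 1)) + w * ?j"
    define g where "g e = ((s + fst e) mod N mod w, (s + snd e) mod N mod w)" for e
    have shift: "fst (g e) + o1 = fst e + s \<and> snd (g e) + o2 = snd e + s" if "e \<in> ?C" for e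
    proof -
      have "inner (fst e)" "inner (snd e)"
        using that by (auto simp: G_def)
      with bead_decomp(1)[of "s + fst e" N w] bead_decomp(1)[of "s + snd e" N w] AB[OF that]
      show ?thesis
        unfolding g_def o1_def o2_def \<sigma>_def inner_def fst_conv snd_conv by (metis add.commute)
    qed
    note sh = nested_shift[OF C(2) shift]
    have ij: "?i \<noteq> ?j" "?i < n" "?j < n"
    proof -
      have "inner (fst e0)" "inner (snd e0)" "\<sigma> (fst e0) mod (n + 1) \<noteq> \<sigma> (snd e0) mod (n + 1)"
        using e0 by (auto simp: G_def)
      then show "?i \<noteq> ?j" "?i < n" "?j < n"
        using section_index_divmod[of "s + fst e0" N w] section_index_divmod[of "s + snd e0" N w]
        by (simp_all add: A_def B_def \<sigma>_def inner_def)
    qed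
    have match': "(col ?i (fst e') = col ?j (snd e')) = v" if "e' \<in> g ` ?C" for e'
    proof -
      from that obtain e where e: "e \<in> ?C" "e' = g e"
        by blast
      then have "inner (fst e)" "inner (snd e)"
        by (auto simp: G_def)
      with bead_decomp(2)[of "s + fst e" N w r] bead_decomp(2)[of "s + snd e" N w r] AB[OF e(1)]
        match[of e] e show ?thesis
        by (simp add: g_def \<sigma>_def inner_def G_def)
    qed
    have "extent (fst ` g ` ?C) \<le> extent (fst ` ?C)"
    proof -
      have "fst ` g ` ?C = (\<lambda>x. (s + x) mod N mod w) ` fst ` ?C"
        by (simp add: image_image g_def)
      moreover have "(s + x) mod N mod w + o1 = x + s" if "x \<in> fst ` ?C" for x
        using that shift by (auto simp: g_def)
      ultimately show ?thesis
        using extent_shift_le[of "fst ` ?C" "\<lambda>x. (s + x) mod N mod w" o1 s] C(1) by simp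
    qed
    moreover have "extent (snd ` g ` ?C) \<le> extent (snd ` ?C)"
    proof -
      have "snd ` g ` ?C = (\<lambda>x. (s + x) mod N mod w) ` snd ` ?C"
        by (simp add: image_image g_def)
      moreover have "(s + x) mod N mod w + o2 = x + s" if "x \<in> snd ` ?C" for x
        using that shift by (auto simp: g_def)
      ultimately show ?thesis
        using extent_shift_le[of "snd ` ?C" "\<lambda>x. (s + x) mod N mod w" o2 s] C(1) by simp
    qed
    ultimately have "(\<rho> + 10 / n) * (extent (fst ` g ` ?C) + extent (snd ` g ` ?C)) \<le>
        (\<rho> + 10 / n) * (extent (fst ` ?C) + extent (snd ` ?C))"
      using \<open>\<rho> + 10 / n \<ge> 0\<close> by (intro mult_left_mono) auto
    moreover have "card (g ` ?C) = card ?C"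
      by (rule card_image[OF sh(2)])
    moreover have "card (g ` ?C) \<le> (\<rho> + 10 / n) * (extent (fst ` g ` ?C) + extent (snd ` g ` ?C)) +
        20 * n ^ (2 * n + 2)"
      using C(1) sh(1) by (intro card_pair_le'[OF _ _ ij match']) auto
    ultimately show "card ?C \<le> (\<rho> + 10 / n) * extent (fst ` ?C) +
        (\<rho> + 10 / n) * extent (snd ` ?C) + 20 * n ^ (2 * n + 2) + 0 * real (card {e\<in>G. key e = k \<and> True})"
      by (simp only: of_nat_add distrib_left mult_zero_left add_0_right)
  qed (use \<open>\<rho> + 10 / n \<ge> 0\<close> in auto)
  moreover have "card (key ` G) \<le> n + 2"
  proof -
    have "key ` G \<subseteq> {- int (n + 1)..0}"
    proof
      fix k assume "k \<in> key ` G"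
      then obtain e where "e \<in> X" "k = key e"
        using G(3) by blast
      with X_bounds[of e] show "k \<in> {- int (n + 1)..0}"
        by (simp add: key_def)
    qed
    from card_mono[OF _ this] show ?thesis
      by simp
  qed
  then have "real (20 * n ^ (2 * n + 2)) * card (key ` G) \<le> real (20 * n ^ (2 * n + 2)) * (n + 2)"
    by (intro mult_left_mono) auto
  \<comment> \<open>Left ends lie below \<open>l\<close> and right ends from \<open>l\<close> on, so
    the two extents share the \<open>N\<close> beads.\<close>
  moreover have "(\<rho> + 10 / n) * extent (fst ` G) + (\<rho> + 10 / n) * extent (snd ` G) \<le> (\<rho> + 10 / n) * N"
  proof -
    have "extent (fst ` G) \<le> l"
      using G(3) dom by (intro extent_le[of _ 0]) auto
    moreover have "extent (snd ` G) \<le> N - l"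
      using G(3) dom l by (intro extent_le[of _ l]) auto
    ultimately have "real (extent (fst ` G) + extent (snd ` G)) \<le> N"
      using l by linarith
    from mult_left_mono[OF this \<open>\<rho> + 10 / n \<ge> 0\<close>] show ?thesis
      by (simp add: distrib_left)
  qed
  moreover have "card X \<le> card G + card H + card {e\<in>X. \<not> inner (fst e)} + card {e\<in>X. \<not> inner (snd e)}"
  proof -
    have "X = (G \<union> H) \<union> {e\<in>X. \<not> inner (fst e)} \<union> {e\<in>X. \<not> inner (snd e)}"
      by (auto simp: G_def H_def)
    then show ?thesis
      using card_Un_le by (metis (no_types, lifting) add_le_mono1 order_trans)
  qed
  with H_le out1 out2 have "card X \<le> card G + 2 * w + 2 * (N - n * w)"
    by linarith
  then have "real (card X) \<le> real (card G) + 2 * real w + 2 * real (N - n * w)"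
    by (simp flip: of_nat_mult of_nat_add)
  ultimately show ?thesis
    by linarith
qed

end

section \<open>Choosing the necklace\<close>

lemma count_list_map_upt: "count_list (map f [0..<N]) c = card {x\<in>{..<N}. f x = c}"
proof (induction N)
  case (Suc N)
  have "{x\<in>{..<Suc N}. f x = c} = {x\<in>{..<N}. f x = c} \<union> (if f N = c then {N} else {})"
    by (auto simp: less_Suc_eq)
  then show ?case
    using Suc by (simp add: card_insert_if)
qed simp

context multiscale
begin

definition necklace :: "nat \<Rightarrow> nat \<Rightarrow> nat \<Rightarrow> color list" where
  "necklace N w r = map (\<lambda>x. if bead w r x then Red else Blue) [0..<N]"

lemma card_col_le: "card {t\<in>{..<w}. col i t = b} \<le> density n a u b * (w + superper i)"
  using card_periodic_le_real[OF superper_pos, of "\<lambda>t. col i t = b" i, OF _ card_col_superper, of 0 w]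
  by (simp add: col_mod_superper lessThan_atLeast0)

lemma density_nonneg: "0 \<le> density n a u b"
  by (simp add: density_def)

lemma card_sections_le:
  assumes "w > 0" "m \<le> n"
  shows "card {x\<in>{..<m * w}. col (x div w) (x mod w) = b} \<le>
    m * (density n a u b * (w + n ^ (2 * n + 2)))"
  using assms(2)
proof (induction m)
  case (Suc m)
  let ?A = "\<lambda>x. col (x div w) (x mod w) = b"
  have "{x\<in>{..<Suc m * w}. ?A x} = {x\<in>{..<m * w}. ?A x} \<union> {x\<in>{m * w..<m * w + w}. ?A x}"
    by auto
  then have "card {x\<in>{..<Suc m * w}. ?A x} \<le>
      card {x\<in>{..<m * w}. ?A x} + card {x\<in>{m * w..<m * w + w}. ?A x}"
    by (simp add: card_Un_le)
  moreover have "card {x\<in>{m * w..<m * w + w}. ?A x} \<le> card {t\<in>{..<w}. col m t = b}"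
  proof (rule card_inj_on_le[where f = "\<lambda>x. x - m * w"])
    show "(\<lambda>x. x - m * w) ` {x\<in>{m * w..<m * w + w}. ?A x} \<subseteq> {t\<in>{..<w}. col m t = b}"
    proof
      fix t assume "t \<in> (\<lambda>x. x - m * w) ` {x\<in>{m * w..<m * w + w}. ?A x}"
      then obtain x where "t = x - m * w" "m * w \<le> x" "x < m * w + w" "?A x"
        by auto
      then have "t < w" "?A (m * w + t)"
        by auto
      then show "t \<in> {t\<in>{..<w}. col m t = b}"
        using assms(1) by simp
    qed
  qed (auto simp: inj_on_def)
  moreover have "card {t\<in>{..<w}. col m t = b} \<le> density n a u b * (w + n ^ (2 * n + 2))"
  proof -
    have "real (w + superper m) \<le> real (w + n ^ (2 * n + 2))"
      using superper_le_max[of m] Suc.prems by (intro of_nat_mono add_left_mono) simp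
    then have "density n a u b * (w + superper m) \<le> density n a u b * (w + n ^ (2 * n + 2))"
      by (rule mult_left_mono[OF _ density_nonneg])
    with card_col_le[of w m b] show ?thesis
      by (rule order_trans)
  qed
  moreover have "card {x\<in>{..<m * w}. ?A x} \<le> m * (density n a u b * (w + n ^ (2 * n + 2)))"
    using Suc by simp
  moreover have "Suc m * (density n a u b * (w + n ^ (2 * n + 2))) =
      m * (density n a u b * (w + n ^ (2 * n + 2))) + density n a u b * (w + n ^ (2 * n + 2))"
    by (simp add: distrib_right)
  ultimately show ?case
    by linarith
qed simp

lemma count_necklace:
  assumes "n * w + r \<le> N"
  shows "count_list (necklace N w r) Red = card {x\<in>{..<n * w}. col (x div w) (x mod w) = True} + r"
proof -
  let ?S = "{x\<in>{..<n * w}. col (x div w) (x mod w) = True}"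
  have "count_list (necklace N w r) Red = card {x\<in>{..<N}. bead w r x}"
    unfolding necklace_def count_list_map_upt by (rule arg_cong[where f = card]) auto
  also have "{x\<in>{..<N}. bead w r x} = ?S \<union> {n * w..<n * w + r}"
    using assms by (auto simp: bead_def)
  also have "card \<dots> = card ?S + r"
    by (subst card_Un_disjoint) auto
  finally show ?thesis .
qed

text \<open>The sections contain at most \<open>K\<close> red and at most \<open>N - K\<close> blue
  beads, so the missing red beads fit into the padding.\<close>

lemma obtain_necklace:
  assumes "w > 0" "K \<le> N"
    and K: "n * (density n a u True * (w + n ^ (2 * n + 2))) \<le> K"
      "n * (density n a u False * (w + n ^ (2 * n + 2))) \<le> real (N - K)"
  obtains r where "n * w + r \<le> N" "count_list (necklace N w r) Red = K"
proof -
  define c where "c b = card {x\<in>{..<n * w}. col (x div w) (x mod w) = b}" for b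
  have "card {..<n * w} = card ({x\<in>{..<n * w}. col (x div w) (x mod w) = True} \<union>
      {x\<in>{..<n * w}. col (x div w) (x mod w) = False})"
    by (rule arg_cong[where f = card]) auto
  also have "\<dots> = c True + c False"
    unfolding c_def by (rule card_Un_disjoint) auto
  finally have "n * w = c True + c False"
    by simp
  moreover have "real (c True) \<le> real K" "real (c False) \<le> real (N - K)"
    using card_sections_le[OF assms(1) order.refl, of True] K(1)
      card_sections_le[OF assms(1) order.refl, of False] K(2)
    unfolding c_def by linarith+
  ultimately have "n * w + (K - c True) \<le> N" "c True + (K - c True) = K"
    using assms(2) by simp_all
  then show ?thesis
    using that[of "K - c True"] count_necklace by (simp add: c_def)
qed

lemma card_proper_matching_le:
  assumes "E = bichromatic \<or> E = monochromatic" "M \<in> proper_matchings E (necklace N w r)"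
    and "w > 0" "n * w \<le> N"
  shows "card M \<le> (\<rho> + 10 / n) * N + real (20 * n ^ (2 * n + 2)) * real (n + 2) +
    2 * real (N - n * w) + 2 * real w"
proof -
  have len: "length (necklace N w r) = N"
    by (simp add: necklace_def)
  have "N > 0"
    using assms(3,4) n by (metis One_nat_def Suc_le_lessD mult_pos_pos order.strict_trans2)
  have "matching N M" "proper N M"
    using assms(2) by (auto simp: proper_matchings_def len)
  then obtain s l X where X: "l \<le> N" "finite X" "nested X" "card X = card M"
    "\<And>e. e \<in> X \<Longrightarrow> fst e < l \<and> l \<le> snd e \<and> snd e < N \<and>
       {(s + fst e) mod N, (s + snd e) mod N} \<in> M"
    by (rule proper_matching_nested) blast
  have nth: "necklace N w r ! x = (if bead w r x then Red else Blue)" if "x < N" for x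
    using that by (simp add: necklace_def)
  \<comment> \<open>The right side is a fixed truth value, false in the bichromatic and true in the
    remaining monochromatic case, so both models are treated at once.\<close>
  have "(bead w r ((s + fst e) mod N) = bead w r ((s + snd e) mod N)) = (E = monochromatic \<and> E \<noteq> bichromatic)"
    if "e \<in> X" for e
  proof -
    let ?x = "(s + fst e) mod N" and ?y = "(s + snd e) mod N"
    have xy: "?x < N" "?y < N" "E (necklace N w r) {?x, ?y}"
      using X(5)[OF that] assms(2) \<open>N > 0\<close> by (auto simp: proper_matchings_def)
    show ?thesis
    proof (cases "E = bichromatic")
      case True
      then obtain x y where "{?x, ?y} = {x, y}" "necklace N w r ! x = Red" "necklace N w r ! y = Blue"
        using xy(3) by (auto simp: bichromatic_def)
      then show ?thesis
        using True xy(1,2) by (auto simp: doubleton_eq_iff nth split: if_splits)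
    next
      case False
      then have mono: "E = monochromatic"
        using assms(1) by blast
      then have "necklace N w r ! ?x = necklace N w r ! ?y"
        using xy(3) unfolding mono monochromatic_def by blast
      then have "bead w r ?x = bead w r ?y"
        unfolding nth[OF xy(1)] nth[OF xy(2)] by (simp split: if_splits)
      then show ?thesis
        using False mono by blast
    qed
  qed
  from card_nested_le[OF X(2,3,1) \<open>N > 0\<close> assms(3,4) _ this] X(5) show ?thesis
    by (simp add: X(4))
qed

lemma min_max_matched_le:
  assumes "E = bichromatic \<or> E = monochromatic" "w > 0" "K \<le> N"
    and K: "int K = \<lfloor>\<phi> / (1 + \<phi>) * real N\<rfloor>"
      "n * (density n a u True * (w + n ^ (2 * n + 2))) \<le> K"
      "n * (density n a u False * (w + n ^ (2 * n + 2))) \<le> real (N - K)"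
  shows "min_max_matched E \<phi> N \<le> 2 * ((\<rho> + 10 / n) * N + real (20 * n ^ (2 * n + 2)) * real (n + 2) +
    2 * real (N - n * w) + 2 * real w)"
proof -
  obtain r where r: "n * w + r \<le> N" "count_list (necklace N w r) Red = K"
    using obtain_necklace[OF assms(2,3) K(2,3)] .
  let ?L = "necklace N w r" and ?P = "proper_matchings E (necklace N w r)"
  have "?L \<in> necklaces \<phi> N"
    using r(2) K(1) by (simp add: necklaces_def necklace_def)
  then have "min_max_matched E \<phi> N \<le> Max ((\<lambda>M. 2 * card M) ` ?P)"
    unfolding min_max_matched_def by (intro Min_le finite_imageI finite_necklaces imageI)
  moreover have "Max ((\<lambda>M. 2 * card M) ` ?P) \<in> (\<lambda>M. 2 * card M) ` ?P"
    using finite_proper_matchings[of E ?L] empty_in_proper_matchings[of E ?L]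
    by (intro Max_in finite_imageI) auto
  then obtain M where M: "M \<in> ?P" "Max ((\<lambda>M. 2 * card M) ` ?P) = 2 * card M"
    by blast
  ultimately have "min_max_matched E \<phi> N \<le> 2 * card M"
    by simp
  then have "real (min_max_matched E \<phi> N) \<le> 2 * real (card M)"
    by linarith
  also have "2 * real (card M) \<le> 2 * ((\<rho> + 10 / n) * N + real (20 * n ^ (2 * n + 2)) * real (n + 2) +
      2 * real (N - n * w) + 2 * real w)"
    using r(1) by (intro mult_left_mono card_proper_matching_le[OF assms(1) M(1) assms(2)]) auto
  finally show ?thesis .
qed

end

section \<open>The limit\<close>

lemma density_conv:
  assumes "n > 0" "a \<le> n" "u \<le> n"
  shows "density n a u True = a / n + u / n * (1 - 2 * (a / n))"
    and "density n a u False = 1 - (a / n + u / n * (1 - 2 * (a / n)))"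
  using assms by (simp_all add: density_def of_nat_diff power2_eq_square field_simps)

text \<open>Rounds \<theta> up and the fraction of red heavy pieces down to multiples of
  \<open>1 / n\<close>; the slack \<open>2 / n\<close> absorbs the effect on the colour
  shares.\<close>

lemma multiscale_exists:
  fixes \<theta> q :: real and n :: nat
  assumes \<theta>: "0 < \<theta>" "\<theta> \<le> 1 / 3" "\<theta> \<le> q" "\<theta> \<le> 1 - q"
    and key: "(1 - 2 * \<theta>) * max q (1 - q) \<le> \<theta> * (1 - \<theta>)" and n: "n \<ge> 30"
  obtains a u where "multiscale n a u (max q (1 - q) + 2 / n) (\<theta> + 2 / n)"
    "density n a u True \<le> q + 2 / n" "density n a u False \<le> 1 - q + 2 / n"
proof -
  \<comment> \<open>The fraction of red heavy pieces that makes the red share exactly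
    \<open>q\<close>; it lies between 0 and 1 because
    \<open>\<theta> \<le> q \<le> 1 - \<theta>\<close>.\<close>
  define x where "x = (q - \<theta>) / (1 - 2 * \<theta>)"
  define a where "a = nat \<lceil>\<theta> * n\<rceil>"
  define u where "u = nat \<lfloor>x * n\<rfloor>"
  define \<tau> where "\<tau> = a / n"
  define y where "y = u / n"
  have x: "0 \<le> x" "x \<le> 1" "q = \<theta> + x * (1 - 2 * \<theta>)"
    using \<theta> by (simp_all add: x_def field_simps)
  have "\<theta> * n \<le> a" "a \<le> \<theta> * n + 1"
    using \<theta>(1) unfolding a_def by (simp_all add: of_nat_ceiling)
  then have \<tau>: "\<theta> \<le> \<tau>" "\<tau> \<le> \<theta> + 1 / n"
    using n by (simp_all add: \<tau>_def field_simps)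
  have "u \<le> x * n" "x * n \<le> u + 1"
    using x(1) unfolding u_def by (simp_all add: of_nat_floor) linarith
  then have y: "y \<le> x" "x \<le> y + 1 / n"
    using n by (simp_all add: y_def field_simps)
  have "1 / real n \<le> 1 / 30"
    using n by (simp add: field_simps)
  then have \<tau>_half: "\<tau> \<le> 1 / 2"
    using \<tau> \<theta>(2) by linarith
  have "2 * real a \<le> real n"
    using \<tau>_half n by (simp add: \<tau>_def field_simps)
  then have a: "2 * a \<le> n"
    by linarith
  have "real u \<le> real n"
    using \<open>u \<le> x * n\<close> mult_right_mono[OF x(2), of n] by simp
  then have u: "u \<le> n"
    by simp
  \<comment> \<open>The red share is affine in each parameter, so its error splits into one term per
    rounding, each at most \<open>1 / n\<close>.\<close>
  have "\<bar>\<tau> + y * (1 - 2 * \<tau>) - q\<bar> = \<bar>(\<tau> - \<theta>) * (1 - 2 * x) + (y - x) * (1 - 2 * \<tau>)\<bar>"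
    by (simp add: x(3) algebra_simps)
  also have "\<dots> \<le> \<bar>\<tau> - \<theta>\<bar> * \<bar>1 - 2 * x\<bar> + \<bar>y - x\<bar> * \<bar>1 - 2 * \<tau>\<bar>"
    by (rule order_trans[OF abs_triangle_ineq]) (simp add: abs_mult)
  also have "\<dots> \<le> 1 / n * 1 + 1 / n * 1"
    using \<tau> y x \<tau>_half \<theta>(1) by (intro add_mono mult_mono) auto
  finally have dev: "\<bar>\<tau> + y * (1 - 2 * \<tau>) - q\<bar> \<le> 2 / n"
    by simp
  have dens: "density n a u True \<le> q + 2 / n" "density n a u False \<le> 1 - q + 2 / n"
    using density_conv[of n a u] dev n a u unfolding \<tau>_def y_def by auto
  have "multiscale n a u (max q (1 - q) + 2 / n) (\<theta> + 2 / n)"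
  proof
    show "density n a u b \<le> max q (1 - q) + 2 / n" for b
      using dens by (cases b) auto
    show "a / n \<le> \<theta> + 2 / n"
      using \<tau>(2) divide_right_mono[of 1 2 "real n"] unfolding \<tau>_def by simp
    show "\<theta> + 2 / n \<le> 1"
      using \<theta>(2) \<open>1 / real n \<le> 1 / 30\<close> by simp
    let ?Q = "max q (1 - q)"
    \<comment> \<open>\<open>(1 - 2 * t) / (1 - t)\<close> decreases in \<open>t\<close>, so
      rounding \<theta> up preserves \<open>key\<close>.\<close>
    have "((1 - 2 * \<tau>) * ?Q) * (1 - \<theta>) \<le> ((1 - 2 * \<theta>) * (1 - \<tau>)) * ?Q"
    proof -
      have "(1 - 2 * \<tau>) * (1 - \<theta>) \<le> (1 - 2 * \<theta>) * (1 - \<tau>)"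
        using \<tau>(1) by (simp add: algebra_simps)
      moreover have "0 \<le> ?Q"
        using \<theta> by (simp add: le_max_iff_disj)
      ultimately have "((1 - 2 * \<tau>) * (1 - \<theta>)) * ?Q \<le> ((1 - 2 * \<theta>) * (1 - \<tau>)) * ?Q"
        by (rule mult_right_mono)
      then show ?thesis
        by (simp only: mult_ac)
    qed
    also have "\<dots> = ((1 - 2 * \<theta>) * ?Q) * (1 - \<tau>)"
      by simp
    also have "\<dots> \<le> (\<theta> * (1 - \<theta>)) * (1 - \<tau>)"
      using key \<tau>_half by (intro mult_right_mono) auto
    finally have "((1 - 2 * \<tau>) * ?Q) * (1 - \<theta>) \<le> (\<theta> * (1 - \<tau>)) * (1 - \<theta>)"
      by (simp add: mult_ac)
    then have "(1 - 2 * \<tau>) * ?Q \<le> \<theta> * (1 - \<tau>)"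
      using \<theta>(2) by (simp only: mult_le_cancel_right)
    moreover have "(1 - 2 * \<tau>) * (2 / n) \<le> (1 - \<tau>) * (2 / n)"
      using \<tau> \<theta> by (intro mult_right_mono) auto
    ultimately show "(1 - 2 * (a / n)) * (?Q + 2 / n) \<le> (\<theta> + 2 / n) * (1 - a / n)"
      unfolding \<tau>_def[symmetric] by (simp add: algebra_simps)
  qed (use n a u in auto)
  then show ?thesis
    using that dens by blast
qed

lemma eventually_min_max_matched_le:
  fixes \<theta> \<phi> :: real and n :: nat
  defines "q \<equiv> \<phi> / (1 + \<phi>)"
  assumes E: "E = bichromatic \<or> E = monochromatic"
    and q: "1 / 3 \<le> q" "q \<le> 2 / 3"
    and \<theta>: "0 < \<theta>" "\<theta> \<le> 1 / 3" "\<theta> \<le> q" "\<theta> \<le> 1 - q"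
    and key: "(1 - 2 * \<theta>) * max q (1 - q) \<le> \<theta> * (1 - \<theta>)" and n30: "n \<ge> 30"
  shows "\<forall>\<^sub>F N in sequentially. real (min_max_matched E \<phi> N) / real N \<le> 2 * \<theta> + 90 / n"
proof -
  obtain a u where ms: "multiscale n a u (max q (1 - q) + 2 / n) (\<theta> + 2 / n)"
    and dens: "density n a u True \<le> q + 2 / n" "density n a u False \<le> 1 - q + 2 / n"
    using multiscale_exists[OF \<theta> key n30] .
  interpret multiscale n a u "max q (1 - q) + 2 / n" "\<theta> + 2 / n"
    by (rule ms)
  define C where "C = n ^ (2 * n + 2)"
  define C' where "C' = real (20 * C) * real (n + 2)"
  have ev: "\<forall>\<^sub>F N in sequentially. c \<le> real N" for c
    using filterlim_real_sequentially by (simp add: filterlim_at_top)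
  show ?thesis
    \<comment> \<open>These thresholds give in turn \<open>w > 0\<close>, room for incomplete
      superperiods, and additive errors of at most \<open>N / n\<close>.\<close>
    using ev[of "2 * real n"] ev[of "real n * (real n * C + 1)"] ev[of "real n * (C' + 2 * n)"]
      eventually_gt_at_top[of 0]
  proof eventually_elim
    case (elim N)
    \<comment> \<open>The fraction of the necklace reserved for padding. A colour share of at least
      1/3 makes this worth \<open>5 / n\<close>, which covers the density error \<open>2 / n\<close>
      and leaves \<open>3 / n\<close>.\<close>
    define h where "h = 15 / real n"
    have h: "0 < h" "h \<le> 1 / 2"
      using n30 by (simp_all add: h_def field_simps)
    define K where "K = nat \<lfloor>q * N\<rfloor>"
    have K: "int K = \<lfloor>q * N\<rfloor>"
      using q by (simp add: K_def)
    then have K_bounds: "q * N - 1 \<le> K" "K \<le> q * N"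
      by linarith+
    have "q * N \<le> 1 * real N"
      using q by (intro mult_right_mono) auto
    then have "K \<le> N"
      using K_bounds by linarith
    define w where "w = nat \<lfloor>(1 - h) * N / n\<rfloor>"
    have "1 / 2 * N / n \<le> (1 - h) * N / n"
      using h by (intro divide_right_mono mult_right_mono) auto
    moreover have "1 \<le> 1 / 2 * N / n"
      using elim(1) n30 by (simp add: field_simps)
    ultimately have "1 \<le> (1 - h) * N / n"
      by linarith
    then have w0: "w > 0" and "real w \<le> (1 - h) * N / n" "(1 - h) * N / n \<le> real w + 1"
      unfolding w_def by (linarith)+
    then have w: "n * real w \<le> (1 - h) * N" "(1 - h) * N \<le> n * real w + n"
      using n30 by (simp_all add: field_simps)
    have "(1 - h) * N \<le> 1 * real N"
      using h by (intro mult_right_mono) auto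
    then have "real (n * w) \<le> real N"
      using w(1) by simp
    then have nw: "n * w \<le> N"
      by (simp only: of_nat_le_iff)
    \<comment> \<open>The \<open>- 1\<close> makes up for the floor in \<open>K\<close>.\<close>
    have dens_le: "n * (density n a u b * (w + n ^ (2 * n + 2))) \<le> p * N - 1"
      if p: "density n a u b \<le> p + 2 / n" "1 / 3 \<le> p" "p \<le> 2 / 3"
      for b and p :: real
    proof -
      let ?d = "density n a u b"
      have "2 / real n \<le> 1 / 3"
        using n30 by (simp add: field_simps)
      then have d1: "?d \<le> 1"
        using p by linarith
      have "n * (?d * (w + n ^ (2 * n + 2))) = ?d * (n * real w) + ?d * (n * real C)"
        by (simp add: C_def algebra_simps)
      also have "\<dots> \<le> ?d * ((1 - h) * N) + 1 * (n * real C)"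
        using d1 density_nonneg[of b] w(1) by (intro add_mono mult_left_mono mult_right_mono) auto
      also have "?d * ((1 - h) * N) \<le> ((p + 2 / n) * (1 - h)) * N"
        using p h by (simp only: mult.assoc[symmetric]) (intro mult_right_mono, auto)
      also have "(p + 2 / n) * (1 - h) \<le> p - 3 / n"
      proof -
        have "5 / n \<le> p * h"
          using p(2) n30 by (simp add: h_def field_simps)
        moreover have "2 / n * (1 - h) \<le> 2 / n * 1"
          using h by (intro mult_left_mono) auto
        moreover have "(p + 2 / n) * (1 - h) = p - p * h + 2 / n * (1 - h)"
          by (simp add: algebra_simps)
        moreover have "2 / real n - 5 / n = - (3 / n)"
          by (simp add: field_simps)
        ultimately show ?thesis
          by linarith
      qed
      finally have "n * (?d * (w + n ^ (2 * n + 2))) \<le> (p - 3 / n) * N + 1 * (n * real C)"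
        by (simp add: mult_right_mono)
      moreover have "real n * C + 1 \<le> 3 / n * N"
        using elim(2) n30 by (simp add: field_simps)
      ultimately show ?thesis
        by (simp add: algebra_simps)
    qed
    have "min_max_matched E \<phi> N \<le> 2 * ((\<theta> + 2 / n + 10 / n) * N + C' + 2 * real (N - n * w) + 2 * real w)"
      unfolding C'_def C_def
    proof (rule min_max_matched_le[OF E w0 \<open>K \<le> N\<close>])
      show "n * (density n a u True * (w + n ^ (2 * n + 2))) \<le> K"
        using dens_le[OF dens(1)] q K_bounds by linarith
      show "n * (density n a u False * (w + n ^ (2 * n + 2))) \<le> real (N - K)"
        using dens_le[OF dens(2)] q K_bounds \<open>K \<le> N\<close> by (simp add: of_nat_diff left_diff_distrib)
    qed (use K in \<open>simp add: q_def\<close>)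
    \<comment> \<open>45 = 12 + 30 + 2 + 1: rounding and pair errors, twice the padding
      \<open>h\<close>, the \<open>2 * w\<close> edges inside sections, and the additive
      terms.\<close>
    also have "\<dots> \<le> 2 * ((\<theta> + 45 / n) * N)"
    proof -
      have "real (N - n * w) \<le> h * N + n"
        using w(2) nw by (simp add: of_nat_diff algebra_simps)
      moreover have "h * N = 15 * (N / n)"
        by (simp add: h_def)
      moreover have "real w \<le> N / n"
        using nw n30 by (simp add: field_simps flip: of_nat_mult)
      moreover have "C' + 2 * n \<le> N / n"
        using elim(3) n30 by (simp add: field_simps)
      moreover have eqs: "(\<theta> + 2 / n + 10 / n) * N = \<theta> * N + 12 * (N / n)" "(\<theta> + 45 / n) * N = \<theta> * N + 45 * (N / n)"
        by (simp_all add: field_simps)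
      ultimately show ?thesis
        unfolding eqs by simp
    qed
    finally show ?case
      using elim(4) by (simp add: field_simps)
  qed
qed

text \<open>\<open>N\<close> tends to infinity for each fixed \<open>n\<close>; afterwards
  \<open>n\<close> does, which removes \<open>90 / n\<close>.\<close>

lemma limsup_min_max_matched_le:
  fixes \<theta> \<phi> :: real
  defines "q \<equiv> \<phi> / (1 + \<phi>)"
  assumes "E = bichromatic \<or> E = monochromatic" "1 / 3 \<le> q" "q \<le> 2 / 3"
    "0 < \<theta>" "\<theta> \<le> 1 / 3" "\<theta> \<le> q" "\<theta> \<le> 1 - q"
    "(1 - 2 * \<theta>) * max q (1 - q) \<le> \<theta> * (1 - \<theta>)"
  shows "limsup (\<lambda>N. ereal (real (min_max_matched E \<phi> N) / real N)) \<le> ereal (2 * \<theta>)"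
proof (rule LIMSEQ_le_const)
  have "(\<lambda>n. 2 * \<theta> + 90 / real n) \<longlonglongrightarrow> 2 * \<theta> + 0"
    by (intro tendsto_add tendsto_const lim_const_over_n)
  then show "(\<lambda>n. ereal (2 * \<theta> + 90 / real n)) \<longlonglongrightarrow> ereal (2 * \<theta>)"
    by simp
  have "limsup (\<lambda>N. ereal (real (min_max_matched E \<phi> N) / real N)) \<le> ereal (2 * \<theta> + 90 / real n)"
    if "n \<ge> 30" for n
    using eventually_min_max_matched_le[of E \<phi> \<theta> n] assms that by (intro Limsup_bounded) simp
  then show "\<exists>m. \<forall>n\<ge>m. limsup (\<lambda>N. ereal (real (min_max_matched E \<phi> N) / real N)) \<le>
      ereal (2 * \<theta> + 90 / real n)"
    by blast
qed

text \<open>\<open>\<theta> = 1 / (\<psi> + 1)\<close> is the root of \<open>(1 - 2\<theta>) / c = \<theta> (1 - \<theta>)\<close>, and the smaller \<open>\<psi>\<close> belongs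
  to the majority colour, whose share is \<open>1 / c\<close>.\<close>

lemma root_bound:
  fixes c \<psi> :: real
  assumes c: "3 / 2 \<le> c" "c \<le> 2" and \<psi>: "\<psi> = (c + sqrt (c\<^sup>2 + 4)) / 2"
  defines "\<theta> \<equiv> 1 / (\<psi> + 1)"
  shows "0 < \<theta>" "\<theta> \<le> 1 / 3" "\<theta> \<le> 1 - 1 / c" "(1 - 2 * \<theta>) * (1 / c) \<le> \<theta> * (1 - \<theta>)"
proof -
  \<comment> \<open>At \<open>c = 3 / 2\<close> the root is exactly 5/2; this gives
    \<open>\<psi> \<ge> 2\<close> and hence \<open>\<theta> \<le> 1 / 3\<close>.\<close>
  have "(5 / 2)\<^sup>2 \<le> c\<^sup>2 + 4"
    using mult_mono[OF c(1) c(1)] c by (simp add: power2_eq_square)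
  then have "5 / 2 \<le> sqrt (c\<^sup>2 + 4)"
    by (rule real_le_rsqrt)
  then have \<psi>2: "\<psi> \<ge> 2"
    using c \<psi> by simp
  have "2 * \<psi> - c = sqrt (c\<^sup>2 + 4)"
    using \<psi> by simp
  then have "(2 * \<psi> - c)\<^sup>2 = c\<^sup>2 + 4"
    by simp
  then have eq: "\<psi>\<^sup>2 = c * \<psi> + 1"
    by (simp add: power2_eq_square algebra_simps)
  show "0 < \<theta>" "\<theta> \<le> 1 / 3"
    using \<psi>2 by (simp_all add: \<theta>_def field_simps)
  moreover have "1 / c \<le> 2 / 3"
    using c by (simp add: field_simps)
  ultimately show "\<theta> \<le> 1 - 1 / c"
    by linarith
  \<comment> \<open>Equality holds: in terms of \<open>\<psi>\<close> it reads
    \<open>(\<psi> - 1) * (\<psi> + 1) = \<psi> * c\<close>, the quadratic equation of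
    \<open>\<psi>\<close>.\<close>
  have "(1 - 2 * \<theta>) * (1 / c) = (\<psi> - 1) / ((\<psi> + 1) * c)"
    using \<psi>2 by (simp add: \<theta>_def field_simps)
  moreover have "\<theta> * (1 - \<theta>) = \<psi> / (\<psi> + 1)\<^sup>2"
    using \<psi>2 by (simp add: \<theta>_def field_simps power2_eq_square)
  moreover have "(\<psi> - 1) / ((\<psi> + 1) * c) = \<psi> / (\<psi> + 1)\<^sup>2"
  proof -
    have "(\<psi> - 1) * (\<psi> + 1) = \<psi> * c"
      using eq by (simp add: power2_eq_square algebra_simps)
    then have "(\<psi> - 1) * (\<psi> + 1)\<^sup>2 = \<psi> * ((\<psi> + 1) * c)"
      by (simp add: power2_eq_square flip: mult.assoc)
    then show ?thesis
      using \<psi>2 c by (simp add: frac_eq_eq)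
  qed
  ultimately show "(1 - 2 * \<theta>) * (1 / c) \<le> \<theta> * (1 - \<theta>)"
    by simp
qed

theorem mainTheorem3:
  fixes \<phi> \<psi>1 \<psi>2 :: real
  assumes "1 / 2 \<le> \<phi>" and "\<phi> \<le> 2"
    and "\<psi>1 = (\<phi> + 1 + sqrt ((\<phi> + 1)\<^sup>2 + 4)) / 2"
    and "\<psi>2 = ((\<phi> + 1) / \<phi> + sqrt (((\<phi> + 1) / \<phi>)\<^sup>2 + 4)) / 2"
  shows "mu_het \<phi> \<le> ereal (max (2 / (\<psi>1 + 1)) (2 / (\<psi>2 + 1))) \<and>
         mu_hom \<phi> \<le> ereal (max (2 / (\<psi>1 + 1)) (2 / (\<psi>2 + 1)))"
proof -
  define q where "q = \<phi> / (1 + \<phi>)"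
  have q: "1 / 3 \<le> q" "q \<le> 2 / 3"
    using assms(1,2) by (simp_all add: q_def field_simps)
  \<comment> \<open>\<open>1 / c\<close> is the share of a majority colour, blue if
    \<open>\<phi> \<le> 1\<close> and red otherwise. The bound for the corresponding
    \<open>\<psi>\<close> is one of the two terms of the maximum.\<close>
  define c where "c = (if \<phi> \<le> 1 then \<phi> + 1 else (\<phi> + 1) / \<phi>)"
  define \<psi> where "\<psi> = (if \<phi> \<le> 1 then \<psi>1 else \<psi>2)"
  have c: "3 / 2 \<le> c" "c \<le> 2"
    using assms(1,2) by (auto simp: c_def field_simps)
  have max_q: "max q (1 - q) = 1 / c" and min_q: "min q (1 - q) = 1 - 1 / c"
  proof -
    have "1 - q = 1 / (\<phi> + 1)" "q = \<phi> / (\<phi> + 1)"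
      using assms(1) by (simp_all add: q_def field_simps)
    moreover have "q \<le> 1 - q \<longleftrightarrow> \<phi> \<le> 1"
      using assms(1) unfolding calculation by (simp add: divide_le_cancel)
    ultimately show "max q (1 - q) = 1 / c" "min q (1 - q) = 1 - 1 / c"
      by (auto simp: c_def max_def min_def)
  qed
  have "\<psi> = (c + sqrt (c\<^sup>2 + 4)) / 2"
    using assms(3,4) by (simp add: c_def \<psi>_def)
  note \<theta> = root_bound[OF c(1,2) this]
  have bound: "limsup (\<lambda>N. ereal (real (min_max_matched E \<phi> N) / real N)) \<le> ereal (2 * (1 / (\<psi> + 1)))"
    if "E = bichromatic \<or> E = monochromatic" for E
    using \<theta> q max_q min_q by (intro limsup_min_max_matched_le[OF that]) (auto simp: q_def[symmetric])
  moreover have "2 * (1 / (\<psi> + 1)) \<le> max (2 / (\<psi>1 + 1)) (2 / (\<psi>2 + 1))"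
    by (simp add: \<psi>_def)
  then have "ereal (2 * (1 / (\<psi> + 1))) \<le> ereal (max (2 / (\<psi>1 + 1)) (2 / (\<psi>2 + 1)))"
    by (simp only: ereal_less_eq)
  ultimately show ?thesis
    unfolding mu_het_def mu_hom_def by (intro conjI; rule order_trans) blast+
qed

end
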